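(* In the game Sim$^+=G_{\text{Avoid-Ramsey}^+}(K_6,K_3,\emptyset,\emptyset)$, the second player, Green, has a winning strategy.
   Context: $G_{\text{Avoid-Ramsey}^+}(K_6,K_3,\emptyset,\emptyset)$: played on the complete graph $K_6$ with all 15 edges initially uncolored. Red and Green alternate moves, Red first. In each move the player colors at least one (possibly several) so-far uncolored edges in his own color (red for Red, green for Green). A player may not make a move after which the edges of his color contain a triangle. The first player unable to make a legal move loses. *)

theory Defs
  imports Main
begin

type_synonym 'v graph = "'v set \<times> 'v set set"

abbreviation verts :: "'v graph \<Rightarrow> 'v set" where "verts \<equiv> fst"
abbreviation edges :: "'v graph \<Rightarrow> 'v set set" where "edges \<equiv> snd"

definition complete_graph :: "nat \<Rightarrow> nat graph" where
  "complete_graph n = ({..<n}, {e. e \<subseteq> {..<n} \<and> card e = 2})"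

definition contains_copy :: "'v graph \<Rightarrow> 'w graph \<Rightarrow> bool" where
  "contains_copy G A \<longleftrightarrow>
     (\<exists>f. inj_on f (verts A) \<and> f ` verts A \<subseteq> verts G \<and> (\<forall>e\<in>edges A. f ` e \<in> edges G))"

datatype player = Red | Green

record ('v, 'w) ramsey_game =
  board :: "'v graph"
  forbidden :: "'w graph"
  initially_red :: "'v set set"
  initially_green :: "'v set set"

text \<open>A move is the set of edges being coloured, and a history is the list of the moves made so
  far, in chronological order.\<close>

type_synonym 'v move = "'v set set"
type_synonym 'v history = "'v move list"

definition mover :: "nat \<Rightarrow> player" where
  "mover i = (if even i then Red else Green)"

definition to_move :: "'v history \<Rightarrow> player" where
  "to_move h = mover (length h)"

fun initial :: "('v, 'w) ramsey_game \<Rightarrow> player \<Rightarrow> 'v set set" where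
  "initial \<Gamma> Red = initially_red \<Gamma>"
| "initial \<Gamma> Green = initially_green \<Gamma>"

definition coloured :: "('v, 'w) ramsey_game \<Rightarrow> 'v history \<Rightarrow> player \<Rightarrow> 'v set set" where
  "coloured \<Gamma> h p = initial \<Gamma> p \<union> \<Union> {h ! i | i. i < length h \<and> mover i = p}"

definition legal_move :: "('v, 'w) ramsey_game \<Rightarrow> 'v history \<Rightarrow> 'v move \<Rightarrow> bool" where
  "legal_move \<Gamma> h M \<longleftrightarrow>
     M \<noteq> {} \<and>
     M \<subseteq> edges (board \<Gamma>) - (coloured \<Gamma> h Red \<union> coloured \<Gamma> h Green) \<and>
     \<not> contains_copy (verts (board \<Gamma>), coloured \<Gamma> h (to_move h) \<union> M) (forbidden \<Gamma>)"

inductive play :: "('v, 'w) ramsey_game \<Rightarrow> 'v history \<Rightarrow> bool" for \<Gamma> where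
  start: "play \<Gamma> []"
| step: "play \<Gamma> h \<Longrightarrow> legal_move \<Gamma> h M \<Longrightarrow> play \<Gamma> (h @ [M])"

definition loses :: "('v, 'w) ramsey_game \<Rightarrow> player \<Rightarrow> 'v history \<Rightarrow> bool" where
  "loses \<Gamma> p h \<longleftrightarrow> play \<Gamma> h \<and> to_move h = p \<and> (\<nexists>M. legal_move \<Gamma> h M)"

definition strategy ::
  "('v, 'w) ramsey_game \<Rightarrow> player \<Rightarrow> ('v history \<Rightarrow> 'v move) \<Rightarrow> bool" where
  "strategy \<Gamma> p \<sigma> \<longleftrightarrow>
     (\<forall>h. play \<Gamma> h \<and> to_move h = p \<and> (\<exists>M. legal_move \<Gamma> h M) \<longrightarrow> legal_move \<Gamma> h (\<sigma> h))"

definition follows :: "player \<Rightarrow> ('v history \<Rightarrow> 'v move) \<Rightarrow> 'v history \<Rightarrow> bool" where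
  "follows p \<sigma> h \<longleftrightarrow> (\<forall>i<length h. mover i = p \<longrightarrow> h ! i = \<sigma> (take i h))"

text \<open>The last clause excludes endless plays, which no one loses. On a board with finitely many
  edges it holds trivially, because each move colours at least one edge.\<close>

definition winning_strategy ::
  "('v, 'w) ramsey_game \<Rightarrow> player \<Rightarrow> ('v history \<Rightarrow> 'v move) \<Rightarrow> bool" where
  "winning_strategy \<Gamma> p \<sigma> \<longleftrightarrow>
     strategy \<Gamma> p \<sigma> \<and>
     (\<forall>h. play \<Gamma> h \<and> follows p \<sigma> h \<longrightarrow> \<not> loses \<Gamma> p h) \<and>
     (\<nexists>m :: nat \<Rightarrow> 'v move. \<forall>n. play \<Gamma> (map m [0..<n]) \<and> follows p \<sigma> (map m [0..<n]))"

definition sim_plus :: "(nat, nat) ramsey_game" where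
  "sim_plus =
     \<lparr>board = complete_graph 6, forbidden = complete_graph 3,
      initially_red = {}, initially_green = {}\<rparr>"

lemma card_edges_complete_graph: "card (edges (complete_graph n)) = n choose 2"
  using n_subsets[of "{..<n}" 2] by (simp add: complete_graph_def)

lemma contains_triangle_iff:
  "contains_copy (V, E) (complete_graph 3) \<longleftrightarrow>
     (\<exists>x\<in>V. \<exists>y\<in>V. \<exists>z\<in>V. x \<noteq> y \<and> y \<noteq> z \<and> x \<noteq> z \<and> {x, y} \<in> E \<and> {y, z} \<in> E \<and> {x, z} \<in> E)"
proof -
  have V3: "{..<3} = {0, 1, 2::nat}"
    by auto
  have E3: "{e. e \<subseteq> {..<3} \<and> card e = 2} = {{0, 1}, {1, 2}, {0, 2::nat}}"
  proof (intro equalityI subsetI)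
    fix e :: "nat set"
    assume "e \<in> {e. e \<subseteq> {..<3} \<and> card e = 2}"
    then obtain x y where "e = {x, y}" "x \<noteq> y" "x \<in> {0, 1, 2}" "y \<in> {0, 1, 2}"
      unfolding V3 by (auto simp: card_2_iff)
    then show "e \<in> {{0, 1}, {1, 2}, {0, 2}}"
      by (elim insertE emptyE) (simp_all add: insert_commute)
  qed auto
  show ?thesis (is "?L \<longleftrightarrow> ?R")
  proof
    assume ?L
    then obtain f :: "nat \<Rightarrow> 'a" where
      "inj_on f {0, 1, 2}" "f ` {0, 1, 2} \<subseteq> V" "\<forall>e\<in>{{0, 1}, {1, 2}, {0, 2}}. f ` e \<in> E"
      unfolding contains_copy_def complete_graph_def fst_conv snd_conv V3[symmetric] E3[symmetric]
      by blast
    then show ?R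
      by (intro bexI[of _ "f 0"] bexI[of _ "f 1"] bexI[of _ "f 2"]) (auto simp: inj_on_def)
  next
    assume ?R
    then obtain x y z where
      *: "x \<in> V" "y \<in> V" "z \<in> V" "x \<noteq> y" "y \<noteq> z" "x \<noteq> z" "{x, y} \<in> E" "{y, z} \<in> E" "{x, z} \<in> E"
      by blast
    define f where "f i = (if i = 0 then x else if i = 1 then y else z)" for i :: nat
    have "inj_on f {0, 1, 2}" "f ` {0, 1, 2} \<subseteq> V" "\<forall>e\<in>{{0, 1}, {1, 2}, {0, 2}}. f ` e \<in> E"
      using * by (auto simp: f_def inj_on_def insert_commute)
    then show ?L
      unfolding contains_copy_def complete_graph_def fst_conv snd_conv V3[symmetric] E3[symmetric]
      by blast
  qed
qed

end

(* Call a position with Green to move closed if she can colour all edges that are still available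
   to Red: this move ends the game. Once it is closed, it stays closed when Red has coloured more
   edges, so only few of Red's moves, built up edge by edge, need another answer. Up to
   permutations of the vertices, 236 positions of the second kind suffice; a table gives a reply to
   each of them, and says for each edge by which Red can enlarge his current move, or start his next
   one, either nothing (then the position is closed or has a red triangle) or an entry to which the
   resulting position is isomorphic. *)

theory Submission
  imports Defs "HOL-Combinatorics.Permutations"
begin

section \<open>Avoidance games on sets of edges\<close>

text \<open>A move is an arbitrary nonempty set of edges, so a direct case distinction over Red's
  moves is exponential. \<open>safe R G\<close> avoids it by asking for a Green win after every
  completion of Red's unfinished move, the empty completion included. The edges of a move carry no
  order, so any one of them may be split off first; a Red move thus becomes a chain of single edges,
  after each of which Red may stop. Closedness persists because a new red edge can only shrink the
  set of edges available to Red, and a subset of a triangle-free green set is triangle-free. The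
  delicate case is a Red move that leaves Red himself nothing more: the closing set is then empty,
  but a move must colour something. A separate test therefore guarantees that Green still has an
  edge to colour. A position is just a pair of edge sets with a turn, so the history is irrelevant
  and relabelling vertices is harmless. Each reference of the table leads to a position with fewer
  uncoloured edges; hence purely local checks of the entries combine to a proof by induction on that
  number, whatever the order of the entries.\<close>

locale avoidance =
  fixes E :: "'e set" and ok :: "'e set \<Rightarrow> bool"
  assumes ok_subset: "ok B \<Longrightarrow> A \<subseteq> B \<Longrightarrow> ok A"
begin

text \<open>The first argument is the colour of the player to move. Both players share the
  definition: Green's moves are \<open>moves G R\<close>, Red's are
  \<open>moves R G\<close>.\<close>

definition moves :: "'e set \<Rightarrow> 'e set \<Rightarrow> 'e set set" where
  "moves A B = {M. M \<noteq> {} \<and> M \<subseteq> E - (A \<union> B) \<and> ok (A \<union> M)}"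

text \<open>In \<open>wins R G\<close> it is Green's turn; in \<open>safe R G\<close> Red may still enlarge his current move,
  or leave it as it is.\<close>

inductive wins :: "'e set \<Rightarrow> 'e set \<Rightarrow> bool" where
  "N \<in> moves G R \<Longrightarrow> (\<And>M. M \<in> moves R (G \<union> N) \<Longrightarrow> wins (R \<union> M) (G \<union> N)) \<Longrightarrow> wins R G"

definition safe :: "'e set \<Rightarrow> 'e set \<Rightarrow> bool" where
  "safe R G \<longleftrightarrow> (\<forall>A \<subseteq> E - (R \<union> G). ok (R \<union> A) \<longrightarrow> wins (R \<union> A) G)"

text \<open>Each of these edges is legal alone, but all of them together may be illegal. Whether
  they are legal together is the question asked below for both players.\<close>

definition playable :: "'e set \<Rightarrow> 'e set \<Rightarrow> 'e set" where
  "playable A B = {e \<in> E - (A \<union> B). ok (insert e A)}"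

lemma safeD: "safe R G \<Longrightarrow> A \<subseteq> E - (R \<union> G) \<Longrightarrow> ok (R \<union> A) \<Longrightarrow> wins (R \<union> A) G"
  by (simp add: safe_def)

text \<open>An edge that Green loses when the red set grows has itself become red, so
  \<open>R \<union> playable G R\<close> can only grow. One test at \<open>R\<close> thus covers all
  later extensions of Red's move.\<close>

lemma alive_mono:
  assumes "\<not> ok (R \<union> playable G R)" "R \<subseteq> R'"
  shows "\<not> ok (R' \<union> playable G R')"
proof -
  have "R \<union> playable G R \<subseteq> R' \<union> playable G R'"
    using assms(2) by (auto simp: playable_def)
  then show ?thesis using assms(1) ok_subset by blast
qed

lemma moves_subset_playable:
  assumes "M \<in> moves A B"
  shows "M \<subseteq> playable A B"
proof
  fix e assume "e \<in> M"
  then have "insert e A \<subseteq> A \<union> M" by blast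
  then show "e \<in> playable A B"
    using assms \<open>e \<in> M\<close> ok_subset unfolding moves_def playable_def by blast
qed

text \<open>Green takes every edge that Red could still colour, which leaves Red without a move. If
  Red's current move already was his last, then Green can make any move; she has one, as
  otherwise Red would have coloured all edges that Green could colour.\<close>

lemma safe_if_closing_move:
  assumes alive: "\<not> ok (R \<union> playable G R)" and close: "ok (G \<union> playable R G)"
  shows "safe R G"
  unfolding safe_def
proof (intro allI impI)
  fix A assume A: "A \<subseteq> E - (R \<union> G)" and ok: "ok (R \<union> A)"
  let ?R = "R \<union> A"
  have sub: "playable ?R G \<subseteq> playable R G"
  proof
    fix e assume "e \<in> playable ?R G"
    moreover have "insert e R \<subseteq> insert e ?R" by blast
    ultimately show "e \<in> playable R G"
      using ok_subset unfolding playable_def by blast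
  qed
  show "wins ?R G"
  proof (cases "playable ?R G = {}")
    case False
    have "playable ?R G \<in> moves G ?R"
      using False ok_subset[OF close, of "G \<union> playable ?R G"] sub
      by (auto simp: moves_def playable_def)
    moreover have "M \<notin> moves ?R (G \<union> playable ?R G)" for M
      using moves_subset_playable[of M ?R "G \<union> playable ?R G"]
      unfolding playable_def moves_def by blast
    ultimately show ?thesis
      by (blast intro: wins.intros)
  next
    case True
    have "\<not> playable G R \<subseteq> A"
      using alive ok ok_subset[of ?R "R \<union> playable G R"] by blast
    then obtain e where "e \<in> playable G R" "e \<notin> A" by blast
    then have "{e} \<in> moves G ?R"
      by (auto simp: moves_def playable_def)
    moreover have "M \<notin> moves ?R (G \<union> {e})" for M
      using moves_subset_playable[of M ?R "G \<union> {e}"] True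
      unfolding playable_def moves_def by blast
    ultimately show ?thesis
      by (blast intro: wins.intros)
  qed
qed

text \<open>This is the recursion behind the table. Either Red has stopped and Green answers with
  \<open>N\<close>, or his move contains a further edge \<open>e\<close>; in both cases Red's
  remaining choices are absorbed by \<open>safe\<close> at a position with one more red
  edge.\<close>

lemma safe_if_reply:
  assumes N: "N \<in> moves G R"
    and more: "\<And>e. e \<in> playable R G \<Longrightarrow> safe (insert e R) G"
    and next_move: "\<And>e. e \<in> playable R (G \<union> N) \<Longrightarrow> safe (insert e R) (G \<union> N)"
  shows "safe R G"
  unfolding safe_def
proof (intro allI impI)
  fix A assume A: "A \<subseteq> E - (R \<union> G)" and ok: "ok (R \<union> A)"
  show "wins (R \<union> A) G"
  proof (cases "A = {}")
    case False
    then obtain e where e: "e \<in> A" by blast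
    \<comment> \<open>Any edge of the completion may count as coloured first; the rest is then a
      completion at \<open>insert e R\<close>.\<close>
    have eq: "insert e R \<union> (A - {e}) = R \<union> A" using e by blast
    have "e \<in> playable R G"
      using moves_subset_playable[of A R G] A ok False e by (auto simp: moves_def)
    then have "wins (insert e R \<union> (A - {e})) G"
      using A ok by (intro safeD[OF more]) (auto simp: eq simp del: Un_insert_left)
    then show ?thesis by (simp only: eq)
  next
    \<comment> \<open>Red has stopped here, so Green plays \<open>N\<close>. Red's next move is
      nonempty, and one of its edges is split off as before.\<close>
    case True
    have "wins (R \<union> M) (G \<union> N)" if M: "M \<in> moves R (G \<union> N)" for M
    proof -
      obtain e where e: "e \<in> M" using M by (auto simp: moves_def)
      have eq: "insert e R \<union> (M - {e}) = R \<union> M" using e by blast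
      have "safe (insert e R) (G \<union> N)"
        using moves_subset_playable[OF M] e next_move by blast
      then have "wins (insert e R \<union> (M - {e})) (G \<union> N)"
        using M by (intro safeD) (auto simp: eq moves_def simp del: Un_insert_left)
      then show ?thesis by (simp only: eq)
    qed
    then show ?thesis using wins.intros[OF N] True by simp
  qed
qed

section \<open>Invariance under permutations of the edges\<close>

lemma wins_image:
  assumes "wins R G" and "bij_betw f E E" and ok_image: "\<And>S. S \<subseteq> E \<Longrightarrow> ok (f ` S) \<longleftrightarrow> ok S"
    and "R \<subseteq> E" "G \<subseteq> E"
  shows "wins (f ` R) (f ` G)"
  using assms(1,4,5)
proof (induction)
  case (1 N G R)
  have image_Diff: "f ` (E - S) = E - f ` S" if "S \<subseteq> E" for S
    using that assms(2) inj_on_image_set_diff[of f E E S] by (auto simp: bij_betw_def)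
  have N: "N \<subseteq> E" using 1(1) by (auto simp: moves_def)
  have "f ` N \<subseteq> f ` (E - (G \<union> R))" using 1(1) by (auto simp: moves_def)
  also have "f ` (E - (G \<union> R)) = E - (f ` G \<union> f ` R)"
    using 1(4,5) by (simp add: image_Diff image_Un)
  finally have fN: "f ` N \<in> moves (f ` G) (f ` R)"
    using 1(1) 1(4,5) N ok_image[of "G \<union> N"] by (auto simp: moves_def image_Un)
  have "wins (f ` R \<union> M') (f ` G \<union> f ` N)" if M': "M' \<in> moves (f ` R) (f ` G \<union> f ` N)" for M'
  proof -
    \<comment> \<open>Every Red move in the image position must be pulled back to a move in the
      original one. This works because \<open>f\<close> maps the uncoloured edges onto the
      uncoloured edges.\<close>
    have "M' \<subseteq> E - f ` (R \<union> (G \<union> N))" using M' by (auto simp: moves_def)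
    then have "M' \<subseteq> f ` (E - (R \<union> (G \<union> N)))"
      using image_Diff[of "R \<union> (G \<union> N)"] 1(4,5) N by simp
    then obtain M where M: "M \<subseteq> E - (R \<union> (G \<union> N))" "M' = f ` M"
      by (meson subset_imageE)
    then have "M \<in> moves R (G \<union> N)"
      using M' ok_image[of "R \<union> M"] 1(4) by (auto simp: moves_def image_Un)
    then show ?thesis
      using 1(3)[of M] 1(4,5) N M by (auto simp: image_Un)
  qed
  then show ?case by (rule wins.intros[OF fN])
qed

lemma safe_image:
  assumes "safe R G" and bij: "bij_betw f E E"
    and ok_image: "\<And>S. S \<subseteq> E \<Longrightarrow> ok (f ` S) \<longleftrightarrow> ok S" and RG: "R \<subseteq> E" "G \<subseteq> E"
  shows "safe (f ` R) (f ` G)"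
  unfolding safe_def
proof (intro allI impI)
  fix A' assume A': "A' \<subseteq> E - (f ` R \<union> f ` G)" "ok (f ` R \<union> A')"
  have "f ` (E - (R \<union> G)) = E - f ` (R \<union> G)"
    using RG bij inj_on_image_set_diff[of f E E "R \<union> G"] by (auto simp: bij_betw_def)
  with A'(1) have "A' \<subseteq> f ` (E - (R \<union> G))" by (simp add: image_Un)
  then obtain A where A: "A \<subseteq> E - (R \<union> G)" "A' = f ` A"
    by (meson subset_imageE)
  have RA: "R \<union> A \<subseteq> E" using A RG by blast
  then have "wins (R \<union> A) G"
    using A A'(2) ok_image[OF RA] by (intro safeD[OF assms(1)]) (auto simp: image_Un)
  from wins_image[OF this bij ok_image RA RG(2)] show "wins (f ` R \<union> A') (f ` G)"
    by (simp add: A(2) image_Un)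
qed

text \<open>The root of the game is not covered by \<open>safe {} {}\<close>, whose empty completion
  would have Green move first. One edge of Red's nonempty opening is split off instead.\<close>

lemma wins_first_move:
  assumes "\<And>e. e \<in> E \<Longrightarrow> safe {e} {}" and "M \<in> moves {} {}"
  shows "wins M {}"
proof -
  obtain e where e: "e \<in> M" "e \<in> E" using assms(2) by (auto simp: moves_def)
  have "wins ({e} \<union> (M - {e})) {}"
    using assms(2) e by (intro safeD[OF assms(1)]) (auto simp: moves_def insert_absorb)
  moreover have "{e} \<union> (M - {e}) = M" using e by blast
  ultimately show ?thesis by simp
qed

end

section \<open>Strategies\<close>

lemma to_move_append: "to_move (h @ [M]) = Red \<longleftrightarrow> to_move h = Green"
  by (simp add: to_move_def mover_def)

lemma coloured_append:
  "coloured \<Gamma> (h @ [M]) p = (if to_move h = p then coloured \<Gamma> h p \<union> M else coloured \<Gamma> h p)"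
proof -
  have eq: "\<Union> {h ! i | i. i < length h \<and> mover i = p} = (\<Union>i\<in>{i. i < length h \<and> mover i = p}. h ! i)"
    for h :: "'a history"
    by blast
  have "{i. i < length (h @ [M]) \<and> mover i = p} =
    {i. i < length h \<and> mover i = p} \<union> (if to_move h = p then {length h} else {})"
    by (auto simp: to_move_def less_Suc_eq)
  moreover have "(\<Union>i\<in>{i. i < length h \<and> mover i = p}. (h @ [M]) ! i) =
    (\<Union>i\<in>{i. i < length h \<and> mover i = p}. h ! i)"
    by (intro SUP_cong) (auto simp: nth_append)
  ultimately show ?thesis unfolding coloured_def eq by auto
qed

lemma follows_append:
  "follows p \<sigma> (h @ [M]) \<longleftrightarrow> follows p \<sigma> h \<and> (to_move h = p \<longrightarrow> M = \<sigma> h)"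
  unfolding follows_def to_move_def by (auto simp: nth_append less_Suc_eq)

text \<open>Each move colours at least one new edge of the board; this bounds the length of plays
  and so excludes endless ones. The intersection with the board keeps the count finite, as the
  initial colourings of a general game may lie outside it.\<close>

lemma length_play_le:
  assumes "finite (edges (board \<Gamma>))" "play \<Gamma> h"
  shows "length h \<le> card ((coloured \<Gamma> h Red \<union> coloured \<Gamma> h Green) \<inter> edges (board \<Gamma>))"
  using assms(2)
proof (induction)
  case (step h M)
  let ?E = "edges (board \<Gamma>)"
  let ?C = "\<lambda>h. (coloured \<Gamma> h Red \<union> coloured \<Gamma> h Green) \<inter> ?E"
  have M: "M \<noteq> {}" "M \<subseteq> ?E" "M \<inter> ?C h = {}"
    using step(2) unfolding legal_move_def by blast+
  have "?C (h @ [M]) = ?C h \<union> M"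
    using M(2) by (cases "to_move h") (auto simp: coloured_append)
  moreover have "card (?C h \<union> M) = card (?C h) + card M"
    using M assms(1) by (intro card_Un_disjoint) (auto intro: finite_subset)
  moreover have "card M > 0"
    using M assms(1) by (meson card_gt_0_iff finite_subset)
  ultimately show ?case using step(3) by simp
qed simp

text \<open>Bridge from positions to histories: a memoryless rule that looks only at the two colour
  classes suffices.\<close>

lemma winning_strategy_if_wins:
  fixes \<Gamma> :: "('v, 'w) ramsey_game"
  defines "E \<equiv> edges (board \<Gamma>)"
    and "ok \<equiv> \<lambda>S. \<not> contains_copy (verts (board \<Gamma>), S) (forbidden \<Gamma>)"
  assumes "avoidance ok" and fin: "finite E"
    and init: "\<And>M. M \<in> avoidance.moves E ok (initially_red \<Gamma>) (initially_green \<Gamma>) \<Longrightarrow>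
      avoidance.wins E ok (initially_red \<Gamma> \<union> M) (initially_green \<Gamma>)"
  shows "\<exists>\<sigma>. winning_strategy \<Gamma> Green \<sigma>"
proof -
  interpret avoidance E ok by fact
  \<comment> \<open>A strategy must give a legal move in every position that has one, even where
    Green is lost. The implication makes one choice serve both ends: a winning move if there is one,
    otherwise any legal move.\<close>
  define reply where "reply R G = (SOME N. N \<in> moves G R \<and>
    ((\<exists>N \<in> moves G R. \<forall>M \<in> moves R (G \<union> N). wins (R \<union> M) (G \<union> N)) \<longrightarrow>
     (\<forall>M \<in> moves R (G \<union> N). wins (R \<union> M) (G \<union> N))))" for R G
  define \<sigma> where "\<sigma> h = reply (coloured \<Gamma> h Red) (coloured \<Gamma> h Green)" for h
  have E': "edges (board \<Gamma>) = E"
    and ok': "contains_copy (verts (board \<Gamma>), S) (forbidden \<Gamma>) \<longleftrightarrow> \<not> ok S" for S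
    by (simp_all add: E_def ok_def)
  have legal: "legal_move \<Gamma> h M \<longleftrightarrow>
    (if to_move h = Red then M \<in> moves (coloured \<Gamma> h Red) (coloured \<Gamma> h Green)
     else M \<in> moves (coloured \<Gamma> h Green) (coloured \<Gamma> h Red))" for h M
    by (cases "to_move h") (auto simp: legal_move_def moves_def E' ok')
  have reply_legal: "reply R G \<in> moves G R" if "M \<in> moves G R" for R G M
    unfolding reply_def by (rule someI2_ex) (use that in blast)+
  have reply_wins: "wins (R \<union> M) (G \<union> reply R G)"
    if w: "wins R G" and M: "M \<in> moves R (G \<union> reply R G)" for R G M
  proof -
    obtain N where "N \<in> moves G R" "\<forall>M \<in> moves R (G \<union> N). wins (R \<union> M) (G \<union> N)"
      using w by (auto elim: wins.cases)
    then have "\<forall>M \<in> moves R (G \<union> reply R G). wins (R \<union> M) (G \<union> reply R G)"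
      unfolding reply_def by (rule_tac someI2_ex) blast+
    then show ?thesis using M by blast
  qed
  have wins_moves: "moves G R \<noteq> {}" if "wins R G" for R G
    using that by (auto elim: wins.cases)
  \<comment> \<open>\<open>wins\<close> speaks only of positions with Green to move, so at Red's
    turn the invariant quantifies over his next move.\<close>
  have inv: "if to_move h = Red
    then \<forall>M \<in> moves (coloured \<Gamma> h Red) (coloured \<Gamma> h Green).
      wins (coloured \<Gamma> h Red \<union> M) (coloured \<Gamma> h Green)
    else wins (coloured \<Gamma> h Red) (coloured \<Gamma> h Green)"
    if "play \<Gamma> h" "follows Green \<sigma> h" for h
    using that
  proof (induction)
    case start
    show ?case using init by (simp add: to_move_def mover_def coloured_def)
  next
    case (step h M)
    then show ?case
      by (cases "to_move h")
        (auto simp: follows_append coloured_append to_move_append legal \<sigma>_def reply_wins)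
  qed
  have "winning_strategy \<Gamma> Green \<sigma>"
    unfolding winning_strategy_def
  proof (intro conjI allI impI notI)
    show "strategy \<Gamma> Green \<sigma>"
      unfolding strategy_def using reply_legal by (auto simp: legal \<sigma>_def)
  next
    fix h assume "play \<Gamma> h \<and> follows Green \<sigma> h" "loses \<Gamma> Green h"
    then show False
      using inv[of h] wins_moves by (fastforce simp: loses_def legal)
  next
    assume "\<exists>m. \<forall>n. play \<Gamma> (map m [0..<n]) \<and> follows Green \<sigma> (map m [0..<n])"
    then obtain m where "play \<Gamma> (map m [0..<Suc (card E)])" by blast
    then have "length (map m [0..<Suc (card E)]) \<le> card E"
      using fin card_mono[OF fin] unfolding E_def
      by (blast intro: order_trans[OF length_play_le])
    then show False by simp
  qed
  then show ?thesis by blast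
qed

section \<open>Triangles in the complete graph on six vertices\<close>

abbreviation K6 :: "nat set set" where
  "K6 \<equiv> edges (complete_graph 6)"

definition triangle_free :: "nat set set \<Rightarrow> bool" where
  "triangle_free S \<longleftrightarrow> \<not> contains_copy ({..<6}, S) (complete_graph 3)"

interpretation sim: avoidance K6 triangle_free
  by standard (simp add: triangle_free_def contains_copy_def, blast)

lemma finite_K6: "finite K6"
  by (rule finite_subset[of _ "Pow {..<6}"]) (auto simp: complete_graph_def)

text \<open>Edges of \<open>K6\<close> have two distinct ends below 6, so the bounds and the
  distinctness in \<open>contains_triangle_iff\<close> come for free.\<close>

lemma triangle_free_iff:
  assumes "S \<subseteq> K6"
  shows "triangle_free S \<longleftrightarrow> \<not> (\<exists>x y z. {x, y} \<in> S \<and> {y, z} \<in> S \<and> {x, z} \<in> S)"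
proof -
  have "x < 6 \<and> y < 6 \<and> x \<noteq> y" if "{x, y} \<in> S" for x y
    using that assms by (auto simp: complete_graph_def card_insert_if split: if_splits)
  then show ?thesis
    unfolding triangle_free_def contains_triangle_iff Bex_def lessThan_iff by metis
qed

text \<open>A triangle that appears with a new edge must contain it, so looking for a common
  neighbour of its ends is enough. This is the basis of the incremental test
  \<open>closes\<close>.\<close>

lemma triangle_free_insert:
  assumes "insert {x, y} S \<subseteq> K6"
  shows "triangle_free (insert {x, y} S) \<longleftrightarrow>
    triangle_free S \<and> \<not> (\<exists>z. {x, z} \<in> S \<and> {y, z} \<in> S)"
proof
  assume L: "triangle_free (insert {x, y} S)"
  then have "\<not> ({x, z} \<in> S \<and> {y, z} \<in> S)" for z
    unfolding triangle_free_iff[OF assms] by blast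
  moreover have "triangle_free S" using L by (rule sim.ok_subset) blast
  ultimately show "triangle_free S \<and> \<not> (\<exists>z. {x, z} \<in> S \<and> {y, z} \<in> S)" by blast
next
  assume R: "triangle_free S \<and> \<not> (\<exists>z. {x, z} \<in> S \<and> {y, z} \<in> S)"
  show "triangle_free (insert {x, y} S)"
    unfolding triangle_free_iff[OF assms]
  proof (intro notI, elim exE conjE)
    fix a b c
    assume abc: "{a, b} \<in> insert {x, y} S" "{b, c} \<in> insert {x, y} S" "{a, c} \<in> insert {x, y} S"
    have ne: "u \<noteq> v" if "{u, v} \<in> insert {x, y} S" for u v
      using that assms by (auto simp: complete_graph_def card_insert_if split: if_splits)
    have "\<not> ({a, b} \<in> S \<and> {b, c} \<in> S \<and> {a, c} \<in> S)"
      using R assms triangle_free_iff[of S] by blast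
    \<comment> \<open>The three sides of the triangle are different sets, so at most one is the new
      edge. The statement is instantiated for each side in this role, with the opposite vertex as
      the common neighbour.\<close>
    moreover have *: "\<not> ({u, w} = {x, y} \<and> {u, v} \<in> S \<and> {w, v} \<in> S)" for u v w
      using R by (auto simp: doubleton_eq_iff)
    moreover have "a \<noteq> b" "b \<noteq> c" "a \<noteq> c"
      using abc[THEN ne] .
    then have "{a, b} \<noteq> {b, c}" "{b, c} \<noteq> {a, c}" "{a, b} \<noteq> {a, c}"
      by (simp_all add: doubleton_eq_iff)
    moreover have "{b, a} = {a, b}" "{c, a} = {a, c}" "{c, b} = {b, c}"
      by (simp_all add: insert_commute)
    ultimately show False
      using abc *[of a b c] *[of b c a] *[of a c b] by (metis insertE)
  qed
qed

section \<open>Symmetry of the complete graph under relabelling of the vertices\<close>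

lemma contains_copy_image:
  assumes "inj_on \<pi> V" "\<pi> ` V = V" "S \<subseteq> Pow V"
  shows "contains_copy (V, (`) \<pi> ` S) H \<longleftrightarrow> contains_copy (V, S) H"
proof
  assume "contains_copy (V, S) H"
  then obtain f where f: "inj_on f (verts H)" "f ` verts H \<subseteq> V" "\<forall>e\<in>edges H. f ` e \<in> S"
    by (auto simp: contains_copy_def)
  have "inj_on (\<pi> \<circ> f) (verts H)"
    using f assms(1) by (meson comp_inj_on inj_on_subset)
  moreover have "(\<pi> \<circ> f) ` verts H \<subseteq> V" "\<forall>e\<in>edges H. (\<pi> \<circ> f) ` e \<in> (`) \<pi> ` S"
    using f assms(2) by (auto simp: image_comp[symmetric])
  ultimately show "contains_copy (V, (`) \<pi> ` S) H"
    unfolding contains_copy_def fst_conv snd_conv by blast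
next
  assume "contains_copy (V, (`) \<pi> ` S) H"
  then obtain f where
    f: "inj_on f (verts H)" "f ` verts H \<subseteq> V" "\<forall>e\<in>edges H. f ` e \<in> (`) \<pi> ` S"
    by (auto simp: contains_copy_def)
  \<comment> \<open>A copy in the image is pulled back by the inverse relabelling. Since every
    member of \<open>S\<close> lies within \<open>V\<close>, the inverse recovers it exactly from
    its image.\<close>
  let ?g = "inv_into V \<pi>"
  have "inj_on (?g \<circ> f) (verts H)"
    using f assms(2) by (metis comp_inj_on inj_on_inv_into)
  moreover have "(?g \<circ> f) ` verts H \<subseteq> V"
    using f(2) by (auto intro!: inv_into_into simp: assms(2))
  moreover have "(?g \<circ> f) ` e \<in> S" if e: "e \<in> edges H" for e
  proof -
    from f(3) e have "f ` e \<in> (`) \<pi> ` S" by (rule bspec)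
    then obtain s where s: "f ` e = \<pi> ` s" "s \<in> S" by (rule imageE)
    have "s \<subseteq> V" using s(2) assms(3) by blast
    then have "?g ` f ` e = s" unfolding s(1) by (rule inv_into_image_cancel[OF assms(1)])
    then show ?thesis using s(2) by (simp only: image_comp)
  qed
  ultimately show "contains_copy (V, S) H"
    unfolding contains_copy_def fst_conv snd_conv by blast
qed

lemma bij_betw_image_K6:
  assumes "bij_betw \<pi> {..<6} {..<6}"
  shows "bij_betw ((`) \<pi>) K6 K6"
proof -
  have inj: "inj_on \<pi> {..<6}" and img: "\<pi> ` {..<6} = {..<6}"
    using assms by (auto simp: bij_betw_def)
  have "inj_on ((`) \<pi>) K6"
    by (rule inj_on_subset[OF inj_on_image_Pow[OF inj]]) (auto simp: complete_graph_def)
  moreover have "(`) \<pi> ` K6 \<subseteq> K6"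
    using inj img by (auto simp: complete_graph_def card_image inj_on_subset)
  ultimately show ?thesis
    using finite_K6 by (simp add: bij_betw_def endo_inj_surj)
qed

lemma safe_vertex_image:
  assumes "bij_betw \<pi> {..<6} {..<6}" "sim.safe R G" "R \<subseteq> K6" "G \<subseteq> K6"
  shows "sim.safe ((`) \<pi> ` R) ((`) \<pi> ` G)"
proof (rule sim.safe_image[OF assms(2) bij_betw_image_K6[OF assms(1)]])
  show "triangle_free ((`) \<pi> ` S) \<longleftrightarrow> triangle_free S" if "S \<subseteq> K6" for S
  proof -
    have "S \<subseteq> Pow {..<6}" using that by (auto simp: complete_graph_def)
    then show ?thesis
      using assms(1) by (simp add: triangle_free_def contains_copy_image bij_betw_def)
  qed
qed (use assms in auto)

section \<open>Checking a table of replies\<close>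

text \<open>Constructors in place of numerals: the checker is run by rewriting, and comparing
  vertices then requires no arithmetic.\<close>

datatype vertex = A | B | C | D | E | F

text \<open>An entry \<open>(R, G, N, rs, rs')\<close> stands for the position with red edges \<open>R\<close> and green edges
  \<open>G\<close>, in which Green replies \<open>N\<close>. The references \<open>rs\<close> concern the edges that Red might have added
  to his move before this reply, and \<open>rs'\<close> those with which he might start his next move. A reference
  \<open>(e, (x, y, k), p)\<close> says that after colouring \<open>e\<close> red, the position is the image of the \<open>k\<close>-th entry
  of \<open>table x y\<close> under the permutation \<open>p\<close>. An arc lists the smaller vertex first. The lookup by
  vertices only serves to keep the terms small that the simplifier has to traverse.\<close>

type_synonym arc = "vertex \<times> vertex"
type_synonym perm = "vertex \<times> vertex \<times> vertex \<times> vertex \<times> vertex \<times> vertex"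
type_synonym index = "vertex \<times> vertex \<times> nat"
type_synonym ref = "arc \<times> index \<times> perm"
type_synonym entry = "arc list \<times> arc list \<times> arc list \<times> ref list \<times> ref list"

fun act :: "perm \<Rightarrow> vertex \<Rightarrow> vertex" where
  "act (a, b, c, d, e, f) A = a"
| "act (a, b, c, d, e, f) B = b"
| "act (a, b, c, d, e, f) C = c"
| "act (a, b, c, d, e, f) D = d"
| "act (a, b, c, d, e, f) E = e"
| "act (a, b, c, d, e, f) F = f"

definition vertices :: "vertex list" where
  "vertices = [A, B, C, D, E, F]"

definition arcs :: "arc list" where
  "arcs = [(A, B), (A, C), (A, D), (A, E), (A, F), (B, C), (B, D), (B, E), (B, F),
     (C, D), (C, E), (C, F), (D, E), (D, F), (E, F)]"

fun nbrs :: "arc list \<Rightarrow> vertex \<Rightarrow> vertex list" where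
  "nbrs [] x = []"
| "nbrs ((a, b) # es) x = (if a = x then [b] else if b = x then [a] else []) @ nbrs es x"

fun meets :: "'a list \<Rightarrow> 'a list \<Rightarrow> bool" where
  "meets [] ys \<longleftrightarrow> False"
| "meets (x # xs) ys \<longleftrightarrow> List.member ys x \<or> meets xs ys"

fun sublist_of :: "'a list \<Rightarrow> 'a list \<Rightarrow> bool" where
  "sublist_of [] ys \<longleftrightarrow> True"
| "sublist_of (x # xs) ys \<longleftrightarrow> List.member ys x \<and> sublist_of xs ys"

fun without :: "'a list \<Rightarrow> 'a list \<Rightarrow> 'a list" where
  "without [] ys = []"
| "without (x # xs) ys = (if List.member ys x then [] else [x]) @ without xs ys"

text \<open>What is closed here is a triangle, by means of a common neighbour of the two ends; this
  is unrelated to closed positions.\<close>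

fun closes :: "arc list \<Rightarrow> arc \<Rightarrow> bool" where
  "closes es (x, y) \<longleftrightarrow> meets (nbrs es x) (nbrs es y)"

text \<open>Each candidate is tested against \<open>es\<close> alone, which makes this the
  executable form of \<open>playable\<close>. In contrast, \<open>extends\<close> tests all its
  candidates jointly, by accumulating those already added.\<close>

fun live :: "arc list \<Rightarrow> arc list \<Rightarrow> arc list" where
  "live es [] = []"
| "live es (f # fs) = (if closes es f then [] else [f]) @ live es fs"

fun extends :: "arc list \<Rightarrow> arc list \<Rightarrow> bool" where
  "extends es [] \<longleftrightarrow> True"
| "extends es (f # fs) \<longleftrightarrow> \<not> closes es f \<and> extends (f # es) fs"

text \<open>A permutation may reverse an arc; this restores the convention that the smaller vertex
  comes first.\<close>

fun orient :: "arc \<Rightarrow> arc" where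
  "orient (x, y) = (if List.member arcs (x, y) then (x, y) else (y, x))"

fun move_arcs :: "perm \<Rightarrow> arc list \<Rightarrow> arc list" where
  "move_arcs p [] = []"
| "move_arcs p ((x, y) # es) = orient (act p x, act p y) # move_arcs p es"

text \<open>Arc lists stand for sets: new arcs are put in front, so their order differs from that in
  the table.\<close>

definition same :: "arc list \<Rightarrow> arc list \<Rightarrow> bool" where
  "same xs ys \<longleftrightarrow> sublist_of xs ys \<and> sublist_of ys xs"

text \<open>Only the head of the list is compared. Taking a list lets an index past the end fail the
  check instead of yielding an unspecified entry. The first conjunct makes \<open>act p\<close>
  surjective, hence a permutation.\<close>

fun matches :: "perm \<Rightarrow> entry list \<Rightarrow> arc list \<Rightarrow> arc list \<Rightarrow> bool" where
  "matches p [] R G \<longleftrightarrow> False"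
| "matches p ((R', G', _) # _) R G \<longleftrightarrow>
     sublist_of vertices (map (act p) vertices) \<and>
     same (move_arcs p R') R \<and> same (move_arcs p G') G"

fun ref_ok ::
  "(vertex \<Rightarrow> vertex \<Rightarrow> entry list) \<Rightarrow> (index \<times> perm) option \<Rightarrow> arc list \<Rightarrow> arc list \<Rightarrow> bool"
where
  "ref_ok tab None R G \<longleftrightarrow> False"
| "ref_ok tab (Some ((x, y, k), p)) R G \<longleftrightarrow> matches p (drop k (tab x y)) R G"

text \<open>The recursion consumes only the last argument; \<open>fs\<close> keeps all uncoloured
  arcs. The three alternatives for an arc are: Red may not colour it, the position becomes closed,
  or a table entry takes over.\<close>

fun exts_ok ::
  "(vertex \<Rightarrow> vertex \<Rightarrow> entry list) \<Rightarrow> ref list \<Rightarrow> arc list \<Rightarrow> arc list \<Rightarrow>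
    arc list \<Rightarrow> arc list \<Rightarrow> bool"
where
  "exts_ok tab rs R G fs [] \<longleftrightarrow> True"
| "exts_ok tab rs R G fs (e # es) \<longleftrightarrow>
     (closes R e \<or> extends G (live (e # R) (without fs [e])) \<or>
      ref_ok tab (map_of rs e) (e # R) G) \<and>
     exts_ok tab rs R G fs es"

text \<open>The first condition makes sure that Red cannot exhaust the edges available to Green.\<close>

definition red_ok ::
  "(vertex \<Rightarrow> vertex \<Rightarrow> entry list) \<Rightarrow> ref list \<Rightarrow> arc list \<Rightarrow> arc list \<Rightarrow> arc list \<Rightarrow> bool"
where
  "red_ok tab rs R G fs \<longleftrightarrow> \<not> extends R (live G fs) \<and> exts_ok tab rs R G fs fs"

text \<open>The conditions mirror \<open>safe_if_reply\<close>: \<open>N\<close> is a legal reply,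
  and the two calls of \<open>red_ok\<close> treat an enlarged current move and the start of the
  next one. \<open>extends []\<close> is the test for being triangle-free.\<close>

fun entry_ok :: "(vertex \<Rightarrow> vertex \<Rightarrow> entry list) \<Rightarrow> entry \<Rightarrow> bool" where
  "entry_ok tab (R, G, N, rs, rs') \<longleftrightarrow>
     sublist_of R arcs \<and> sublist_of G arcs \<and> extends [] R \<and> extends [] G \<and>
     N \<noteq> [] \<and> sublist_of N (without arcs (R @ G)) \<and> extends G N \<and>
     red_ok tab rs R G (without arcs (R @ G)) \<and>
     red_ok tab rs' R (N @ G) (without arcs (R @ N @ G))"

section \<open>Translation from arcs to the edges of \<open>K6\<close>\<close>

primrec num :: "vertex \<Rightarrow> nat" where
  "num A = 0" | "num B = 1" | "num C = 2" | "num D = 3" | "num E = 4" | "num F = 5"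

definition edge :: "arc \<Rightarrow> nat set" where
  "edge e = {num (fst e), num (snd e)}"

definition edge_set :: "arc list \<Rightarrow> nat set set" where
  "edge_set es = edge ` set es"

lemma edge_set_simps [simp]:
  "edge_set [] = {}" "edge_set (e # es) = insert (edge e) (edge_set es)"
  "edge_set (es @ fs) = edge_set es \<union> edge_set fs"
  by (auto simp: edge_set_def)

lemma inj_num: "inj num"
proof (rule injI)
  show "x = y" if "num x = num y" for x y using that by (cases x; cases y) auto
qed

lemma num_less: "num x < 6"
  by (cases x) simp_all

lemma range_num: "range num = {..<6}"
proof (intro equalityI subsetI)
  fix n :: nat assume "n \<in> {..<6}"
  then have "n \<in> {0, 1, 2, 3, 4, 5}" by auto
  moreover have "{0, 1, 2, 3, 4, 5} = num ` {A, B, C, D, E, F}" by simp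
  ultimately show "n \<in> range num" by blast
qed (use num_less in auto)

lemma num_eq [simp]: "num x = num y \<longleftrightarrow> x = y"
  using inj_num by (auto dest: injD)

lemma set_vertices: "set vertices = UNIV"
proof -
  have "x \<in> set vertices" for x by (cases x) (simp_all add: vertices_def)
  then show ?thesis by blast
qed

lemma arcs_cases: "x \<noteq> y \<Longrightarrow> (x, y) \<in> set arcs \<or> (y, x) \<in> set arcs"
  by (cases x; cases y) (simp_all add: arcs_def)

lemma arcs_irrefl: "(x, y) \<in> set arcs \<Longrightarrow> x \<noteq> y"
  by (auto simp: arcs_def)

text \<open>Only one orientation of each edge occurs in \<open>arcs\<close>. Injectivity is what
  makes removing arcs from a list agree with the difference of edge sets.\<close>

lemma inj_on_edge: "inj_on edge (set arcs)"
proof (rule inj_onI)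
  fix e f assume ef: "e \<in> set arcs" "f \<in> set arcs" "edge e = edge f"
  obtain x y where e: "e = (x, y)" by force
  have "(y, x) \<notin> set arcs" using ef(1) by (auto simp: e arcs_def)
  moreover have "f = (x, y) \<or> f = (y, x)"
    using ef(3) by (cases f) (auto simp: e edge_def doubleton_eq_iff)
  ultimately show "e = f" using ef(2) e by auto
qed

lemma edge_set_arcs: "edge_set arcs = K6"
proof (intro equalityI subsetI)
  fix e assume "e \<in> edge_set arcs"
  then show "e \<in> K6"
    using num_less by (auto simp: edge_set_def edge_def complete_graph_def dest: arcs_irrefl)
next
  fix e assume "e \<in> K6"
  then obtain a b where ab: "e = {a, b}" "a \<noteq> b" "a < 6" "b < 6"
    by (auto simp: complete_graph_def card_2_iff)
  then obtain x y where "a = num x" "b = num y"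
    using range_num by (metis imageE lessThan_iff)
  then show "e \<in> edge_set arcs"
    using ab arcs_cases[of x y] by (force simp: edge_set_def edge_def)
qed

lemma edge_set_subset: "set es \<subseteq> set arcs \<Longrightarrow> edge_set es \<subseteq> K6"
  using edge_set_arcs by (auto simp: edge_set_def)

section \<open>Correctness of the list operations\<close>

lemma sublist_of_iff: "sublist_of xs ys \<longleftrightarrow> set xs \<subseteq> set ys"
  by (induction xs) (auto simp: List.member_iff)

lemma set_without [simp]: "set (without xs ys) = set xs - set ys"
  by (induction xs) (auto simp: List.member_iff)

lemma meets_iff: "meets xs ys \<longleftrightarrow> set xs \<inter> set ys \<noteq> {}"
  by (induction xs) (auto simp: List.member_iff)

lemma set_nbrs: "z \<in> set (nbrs es x) \<longleftrightarrow> {num x, num z} \<in> edge_set es"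
  by (induction es x rule: nbrs.induct) (simp, simp add: edge_def doubleton_eq_iff, blast)

lemma edge_set_without:
  assumes "set fs \<subseteq> set arcs" "set es \<subseteq> set arcs"
  shows "edge_set (without fs es) = edge_set fs - edge_set es"
  using assms inj_on_image_set_diff[OF inj_on_edge, of "set fs" "set es"]
  by (auto simp: edge_set_def)

lemma closes_iff:
  assumes es: "set es \<subseteq> set arcs" and e: "e \<in> set arcs" and "triangle_free (edge_set es)"
  shows "closes es e \<longleftrightarrow> \<not> triangle_free (insert (edge e) (edge_set es))"
proof -
  obtain x y where xy: "e = (x, y)" by force
  have "closes es e \<longleftrightarrow> (\<exists>z. {num x, num z} \<in> edge_set es \<and> {num y, num z} \<in> edge_set es)"
    by (auto simp: xy meets_iff set_nbrs)
  also have "\<dots> \<longleftrightarrow> (\<exists>n. {num x, n} \<in> edge_set es \<and> {num y, n} \<in> edge_set es)"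
  proof -
    \<comment> \<open>On the graph side a common neighbour is an arbitrary natural number; lying on
      an edge of \<open>K6\<close>, it is the number of some vertex.\<close>
    have "n \<in> range num" if "{num x, n} \<in> edge_set es" for n
      using that edge_set_subset[OF es] unfolding range_num by (auto simp: complete_graph_def)
    then show ?thesis by blast
  qed
  finally show ?thesis
    using assms triangle_free_insert[of "num x" "num y" "edge_set es"] edge_set_subset[of "e # es"]
    by (simp add: xy edge_def)
qed

text \<open>The first list grows as arcs are accepted, so the induction generalises over it; each
  acceptance keeps it triangle-free, as \<open>closes_iff\<close> requires.\<close>

lemma extends_iff:
  assumes "set es \<subseteq> set arcs" "set fs \<subseteq> set arcs" "triangle_free (edge_set es)"
  shows "extends es fs \<longleftrightarrow> triangle_free (edge_set es \<union> edge_set fs)"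
  using assms
proof (induction fs arbitrary: es)
  case (Cons f fs)
  show ?case
  proof (cases "closes es f")
    case True
    then have "\<not> triangle_free (edge_set es \<union> edge_set (f # fs))"
      using Cons.prems closes_iff[of es f]
        sim.ok_subset[of "edge_set es \<union> edge_set (f # fs)" "insert (edge f) (edge_set es)"]
      by auto
    with True show ?thesis by simp
  next
    case False
    then show ?thesis
      using Cons.prems closes_iff[of es f] Cons.IH[of "f # es"] by simp
  qed
qed simp

lemma set_live_subset: "set (live es fs) \<subseteq> set fs"
  by (induction fs) auto

lemma edge_set_live:
  assumes "set es \<subseteq> set arcs" "set fs \<subseteq> set arcs" "triangle_free (edge_set es)"
  shows "edge_set (live es fs) = {e \<in> edge_set fs. triangle_free (insert e (edge_set es))}"
  using assms(2)
proof (induction fs)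
  case (Cons f fs)
  then show ?case using closes_iff[of es f] assms by auto
qed simp

text \<open>The list \<open>fs\<close> is fixed only as a set and the two colours enter
  symmetrically, so the same list of uncoloured arcs computes the playable edges of either
  player.\<close>

lemma edge_set_live_eq_playable:
  assumes "set es \<subseteq> set arcs" "set fs = set arcs - set (es @ gs)" "set gs \<subseteq> set arcs"
    "triangle_free (edge_set es)"
  shows "edge_set (live es fs) = sim.playable (edge_set es) (edge_set gs)"
proof -
  have "edge_set fs = edge_set (without arcs (es @ gs))"
    using assms(2) by (simp add: edge_set_def)
  then have "edge_set fs = K6 - (edge_set es \<union> edge_set gs)"
    using assms edge_set_without[of arcs "es @ gs"] by (simp add: edge_set_arcs)
  then show ?thesis
    using assms edge_set_live[of es fs] by (auto simp: sim.playable_def)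
qed

section \<open>Soundness of references and of the table check\<close>

lemma edge_set_move_arcs:
  "edge_set (move_arcs p es) = (`) (num \<circ> act p \<circ> inv num) ` edge_set es"
proof -
  \<comment> \<open>The vertex permutation is conjugated by \<open>num\<close> to act on numbers;
    reorienting an arc has no effect on the underlying edge.\<close>
  have "edge (orient (act p x, act p y)) = (num \<circ> act p \<circ> inv num) ` edge (x, y)" for x y
    by (auto simp: edge_def inv_f_f[OF inj_num])
  then show ?thesis by (induction p es rule: move_arcs.induct) simp_all
qed

text \<open>Surjectivity, which is what the checker tests, implies injectivity on a finite
  type.\<close>

lemma bij_act:
  assumes "sublist_of vertices (map (act p) vertices)"
  shows "bij_betw (num \<circ> act p \<circ> inv num) {..<6} {..<6}"
proof -
  have fin: "finite (UNIV :: vertex set)" unfolding set_vertices[symmetric] by simp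
  have "surj (act p)"
    using assms set_vertices by (auto simp: sublist_of_iff)
  then have "bij (act p)" using fin by (simp add: bij_def finite_UNIV_surj_inj)
  moreover have "bij_betw num UNIV {..<6}" using inj_num range_num by (simp add: bij_betw_def)
  ultimately show ?thesis
    by (meson bij_betw_inv_into bij_betw_trans)
qed

text \<open>Relabelling preserves the number of uncoloured edges. The assumption on the table
  therefore concerns only entries with exactly as many uncoloured edges as the present position,
  which suits an induction on that number.\<close>

lemma ref_ok_safe:
  assumes "ref_ok tab r R G"
    and IH: "\<And>x y R' G' d. (R', G', d) \<in> set (tab x y) \<Longrightarrow>
      card (K6 - (edge_set R' \<union> edge_set G')) = card (K6 - (edge_set R \<union> edge_set G)) \<Longrightarrow>
      sim.safe (edge_set R') (edge_set G')"
    and sub: "\<And>x y R' G' d. (R', G', d) \<in> set (tab x y) \<Longrightarrow> set R' \<subseteq> set arcs \<and> set G' \<subseteq> set arcs"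
  shows "sim.safe (edge_set R) (edge_set G)"
proof -
  obtain x y k p where r: "r = Some ((x, y, k), p)"
    using assms(1) by (cases "(tab, r, R, G)" rule: ref_ok.cases) auto
  then have m: "matches p (drop k (tab x y)) R G" using assms(1) by simp
  then obtain R' G' d ds where d: "drop k (tab x y) = (R', G', d) # ds"
    by (cases "(p, drop k (tab x y), R, G)" rule: matches.cases) auto
  then have mem: "(R', G', d) \<in> set (tab x y)"
    by (metis in_set_dropD list.set_intros(1))
  let ?\<pi> = "num \<circ> act p \<circ> inv num"
  have bij: "bij_betw ?\<pi> {..<6} {..<6}" using m d by (simp add: bij_act)
  have R: "edge_set R = (`) ?\<pi> ` edge_set R'" and G: "edge_set G = (`) ?\<pi> ` edge_set G'"
  proof -
    have "set (move_arcs p R') = set R" "set (move_arcs p G') = set G"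
      using m unfolding d by (auto simp: same_def sublist_of_iff)
    then have "edge_set (move_arcs p R') = edge_set R" "edge_set (move_arcs p G') = edge_set G"
      by (simp_all add: edge_set_def)
    then show "edge_set R = (`) ?\<pi> ` edge_set R'" "edge_set G = (`) ?\<pi> ` edge_set G'"
      by (simp_all only: edge_set_move_arcs)
  qed
  have K: "edge_set R' \<subseteq> K6" "edge_set G' \<subseteq> K6"
    using sub[OF mem] edge_set_subset by auto
  have inj: "inj_on ((`) ?\<pi>) K6" and img: "(`) ?\<pi> ` K6 = K6"
    using bij_betw_image_K6[OF bij] by (auto simp: bij_betw_def)
  have "card (edge_set R \<union> edge_set G) = card (edge_set R' \<union> edge_set G')"
    unfolding R G image_Un[symmetric] using K by (intro card_image) (meson inj Un_least inj_on_subset)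
  moreover have "edge_set R \<union> edge_set G \<subseteq> K6"
    unfolding R G image_Un[symmetric] by (subst img[symmetric]) (intro image_mono Un_least K)
  ultimately have "card (K6 - (edge_set R' \<union> edge_set G')) = card (K6 - (edge_set R \<union> edge_set G))"
    using K finite_K6 by (simp add: card_Diff_subset finite_subset[OF _ finite_K6])
  then show ?thesis
    unfolding R G using IH[OF mem] K bij by (intro safe_vertex_image) (simp_all add: R G)
qed

lemma exts_okD:
  "exts_ok tab rs R G fs es \<Longrightarrow> a \<in> set es \<Longrightarrow>
    closes R a \<or> extends G (live (a # R) (without fs [a])) \<or> ref_ok tab (map_of rs a) (a # R) G"
  by (induction es) auto

text \<open>One edge of Red's play, used for both reference lists of an entry. Colouring it lowers
  the number of uncoloured edges, so the induction hypothesis applies to any entry referred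
  to.\<close>

lemma red_ok_safe:
  assumes red: "red_ok tab rs R G fs"
    and fs: "set fs = set arcs - set (R @ G)"
    and arcs: "set R \<subseteq> set arcs" "set G \<subseteq> set arcs"
    and tf: "triangle_free (edge_set R)" "triangle_free (edge_set G)"
    and IH: "\<And>x y R' G' d. (R', G', d) \<in> set (tab x y) \<Longrightarrow>
      card (K6 - (edge_set R' \<union> edge_set G')) < card (K6 - (edge_set R \<union> edge_set G)) \<Longrightarrow>
      sim.safe (edge_set R') (edge_set G')"
    and sub: "\<And>x y R' G' d. (R', G', d) \<in> set (tab x y) \<Longrightarrow> set R' \<subseteq> set arcs \<and> set G' \<subseteq> set arcs"
    and e: "e \<in> sim.playable (edge_set R) (edge_set G)"
  shows "sim.safe (insert e (edge_set R)) (edge_set G)"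
proof -
  have "e \<in> edge_set (live R fs)"
    using e edge_set_live_eq_playable[of R fs G] fs arcs tf by simp
  then obtain a where a: "a \<in> set fs" "e = edge a"
    using set_live_subset[of R fs] by (auto simp: edge_set_def)
  have aA: "a \<in> set arcs" "a \<notin> set R" "a \<notin> set G" using a fs by auto
  have tfa: "triangle_free (edge_set (a # R))" using e a by (simp add: sim.playable_def)
  have fs': "set (without fs [a]) = set arcs - set ((a # R) @ G)" using fs by auto
  have "\<not> triangle_free (edge_set R \<union> sim.playable (edge_set G) (edge_set R))"
    using red fs arcs tf extends_iff[of R "live G fs"] set_live_subset[of G fs]
      edge_set_live_eq_playable[of G fs R]
    by (auto simp: red_ok_def Un_commute)
  \<comment> \<open>The test was made before \<open>a\<close> became red; by monotonicity it still
    holds afterwards.\<close>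
  then have alive:
    "\<not> triangle_free (edge_set (a # R) \<union> sim.playable (edge_set G) (edge_set (a # R)))"
    using sim.alive_mono by (metis edge_set_simps(2) subset_insertI)
  have "closes R a \<or> extends G (live (a # R) (without fs [a])) \<or>
      ref_ok tab (map_of rs a) (a # R) G"
    using red a(1) exts_okD unfolding red_ok_def by blast
  then have "sim.safe (edge_set (a # R)) (edge_set G)"
  proof (elim disjE)
    assume "closes R a"
    then show ?thesis using closes_iff[of R a] aA arcs tf tfa by simp
  next
    assume ext: "extends G (live (a # R) (without fs [a]))"
    have "set (live (a # R) (without fs [a])) \<subseteq> set arcs"
      using set_live_subset fs' by blast
    then have "triangle_free (edge_set G \<union> sim.playable (edge_set (a # R)) (edge_set G))"
      using ext extends_iff[of G] arcs tf aA tfa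
        edge_set_live_eq_playable[of "a # R" "without fs [a]" G] fs' by simp
    then show ?thesis by (rule sim.safe_if_closing_move[OF alive])
  next
    assume "ref_ok tab (map_of rs a) (a # R) G"
    then show ?thesis
    proof (rule ref_ok_safe[OF _ _ sub])
      fix x y R' G' d
      assume d: "(R', G', d) \<in> set (tab x y)"
        and eq: "card (K6 - (edge_set R' \<union> edge_set G')) =
          card (K6 - (edge_set (a # R) \<union> edge_set G))"
      have "K6 - (edge_set (a # R) \<union> edge_set G) \<subset> K6 - (edge_set R \<union> edge_set G)"
        using e a(2) by (auto simp: sim.playable_def)
      then have "card (K6 - (edge_set (a # R) \<union> edge_set G)) < card (K6 - (edge_set R \<union> edge_set G))"
        using finite_K6 by (intro psubset_card_mono) auto
      then show "sim.safe (edge_set R') (edge_set G')" using IH[OF d] eq by simp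
    qed
  qed
  then show ?thesis by (simp add: a(2))
qed

text \<open>Since following a reference always costs an uncoloured edge, the references cannot run
  in a circle, and the local checks suffice. The induction ranges over all entries at once, because
  a reference may point anywhere in the table.\<close>

lemma entries_safe:
  assumes "\<And>x y d. d \<in> set (tab x y) \<Longrightarrow> entry_ok tab d"
    and "(R, G, d) \<in> set (tab x y)"
  shows "sim.safe (edge_set R) (edge_set G)"
  using assms(2)
proof (induction "card (K6 - (edge_set R \<union> edge_set G))" arbitrary: x y R G d rule: less_induct)
  case less
  obtain N rs rs' where d: "d = (N, rs, rs')" by (cases d) auto
  have ok: "entry_ok tab (R, G, N, rs, rs')" using assms(1) less.prems d by blast
  have sub: "set R' \<subseteq> set arcs \<and> set G' \<subseteq> set arcs" if "(R', G', d') \<in> set (tab x y)" for x y R' G' d'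
    using assms(1)[OF that] by (cases d') (simp add: sublist_of_iff)
  have arcs: "set R \<subseteq> set arcs" "set G \<subseteq> set arcs" "set N \<subseteq> set arcs - set (R @ G)"
    using ok by (auto simp: sublist_of_iff)
  have "triangle_free {}" by (simp add: triangle_free_def contains_triangle_iff)
  then have tf: "triangle_free (edge_set R)" "triangle_free (edge_set G)"
    using ok arcs extends_iff[of "[]"] by auto
  have tfN: "triangle_free (edge_set (N @ G))"
    using ok arcs tf extends_iff[of G N] by (auto simp: Un_commute)
  have "edge_set N \<subseteq> edge_set (without arcs (R @ G))"
    using arcs(3) by (auto simp: edge_set_def)
  then have "edge_set N \<subseteq> K6 - (edge_set R \<union> edge_set G)"
    using arcs edge_set_without[of arcs "R @ G"] by (simp add: edge_set_arcs)
  moreover have "edge_set N \<noteq> {}" using ok by (simp add: edge_set_def)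
  ultimately have N: "edge_set N \<in> sim.moves (edge_set G) (edge_set R)"
    using tfN by (auto simp: sim.moves_def Un_commute)
  show ?case
  proof (rule sim.safe_if_reply[OF N])
    fix e assume "e \<in> sim.playable (edge_set R) (edge_set G)"
    then show "sim.safe (insert e (edge_set R)) (edge_set G)"
      using ok arcs tf less.hyps sub
      by (intro red_ok_safe[of tab rs R G "without arcs (R @ G)"]) auto
  next
    fix e assume e: "e \<in> sim.playable (edge_set R) (edge_set G \<union> edge_set N)"
    \<comment> \<open>Green's reply only lowers the measure, so the bound obtained relative to the
      position after \<open>N\<close> also suits the induction at the position before it.\<close>
    have le: "card (K6 - (edge_set R \<union> edge_set (N @ G))) \<le> card (K6 - (edge_set R \<union> edge_set G))"
      using finite_K6 by (intro card_mono) auto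
    have "sim.safe (insert e (edge_set R)) (edge_set (N @ G))"
    proof (rule red_ok_safe[of tab rs' R "N @ G" "without arcs (R @ N @ G)"])
      show "sim.safe (edge_set R') (edge_set G')"
        if "(R', G', d') \<in> set (tab x y)"
          "card (K6 - (edge_set R' \<union> edge_set G')) < card (K6 - (edge_set R \<union> edge_set (N @ G)))"
        for x y R' G' d'
        using less.hyps[OF _ that(1)] that(2) le by simp
    qed (use ok arcs tf tfN sub e in \<open>auto simp: Un_commute\<close>)
    then show "sim.safe (insert e (edge_set R)) (edge_set G \<union> edge_set N)"
      by (simp add: Un_commute)
  qed
qed

section \<open>The table of replies\<close>

text \<open>Being abbreviations, these names vanish on parsing, and the checker meets plain pairs of
  constructors.\<close>

abbreviation AB :: arc where "AB \<equiv> (A, B)"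
abbreviation AC :: arc where "AC \<equiv> (A, C)"
abbreviation AD :: arc where "AD \<equiv> (A, D)"
abbreviation AE :: arc where "AE \<equiv> (A, E)"
abbreviation AF :: arc where "AF \<equiv> (A, F)"
abbreviation BC :: arc where "BC \<equiv> (B, C)"
abbreviation BD :: arc where "BD \<equiv> (B, D)"
abbreviation BE :: arc where "BE \<equiv> (B, E)"
abbreviation BF :: arc where "BF \<equiv> (B, F)"
abbreviation CD :: arc where "CD \<equiv> (C, D)"
abbreviation CE :: arc where "CE \<equiv> (C, E)"
abbreviation CF :: arc where "CF \<equiv> (C, F)"
abbreviation DE :: arc where "DE \<equiv> (D, E)"
abbreviation DF :: arc where "DF \<equiv> (D, F)"
abbreviation EF :: arc where "EF \<equiv> (E, F)"

text \<open>Found by exhaustive search on a computer.\<close>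

definition table :: "vertex \<Rightarrow> vertex \<Rightarrow> entry list" where
  "table x y = (case (x, y) of
     (A, A) \<Rightarrow>
     [([AB], [], [EF],
       [(AC, (A, A, 1), A, B, C, D, E, F), (AD, (A, A, 1), A, B, D, C, E, F),
        (AE, (A, A, 1), A, B, E, C, D, F), (AF, (A, A, 1), A, B, F, C, D, E),
        (BC, (A, A, 1), B, A, C, D, E, F), (BD, (A, A, 1), B, A, D, C, E, F),
        (BE, (A, A, 1), B, A, E, C, D, F), (BF, (A, A, 1), B, A, F, C, D, E),
        (CD, (A, A, 2), A, C, D, B, E, F), (CE, (A, A, 2), A, C, E, B, D, F),
        (CF, (A, A, 2), A, C, F, B, D, E), (DE, (A, A, 2), A, D, E, B, C, F),
        (DF, (A, A, 2), A, D, F, B, C, E), (EF, (A, A, 2), A, E, F, B, C, D)],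
       [(AC, (A, A, 3), E, F, A, B, C, D), (AD, (A, A, 3), E, F, A, B, D, C),
        (AE, (A, A, 4), E, F, A, B, C, D), (AF, (A, A, 4), F, E, A, B, C, D),
        (BC, (A, A, 3), E, F, B, A, C, D), (BD, (A, A, 3), E, F, B, A, D, C),
        (BE, (A, A, 4), E, F, B, A, C, D), (BF, (A, A, 4), F, E, B, A, C, D),
        (CD, (A, A, 5), E, F, A, C, D, B), (CE, (A, A, 6), E, F, A, B, C, D),
        (CF, (A, A, 6), F, E, A, B, C, D), (DE, (A, A, 6), E, F, A, B, D, C),
        (DF, (A, A, 6), F, E, A, B, D, C)]),
      ([AB, AC], [], [AD, EF],
       [(AD, (A, B, 0), A, B, C, D, E, F), (AE, (A, B, 0), A, B, C, E, D, F),
        (AF, (A, B, 0), A, B, C, F, D, E), (BD, (A, B, 1), A, B, D, C, E, F),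
        (BE, (A, B, 1), A, B, E, C, D, F), (BF, (A, B, 1), A, B, F, C, D, E),
        (CD, (A, B, 1), A, C, D, B, E, F), (CE, (A, B, 1), A, C, E, B, D, F),
        (CF, (A, B, 1), A, C, F, B, D, E), (DE, (A, B, 2), A, D, E, B, C, F),
        (DF, (A, B, 2), A, D, F, B, C, E), (EF, (A, B, 2), A, E, F, B, C, D)],
       [(AE, (A, E, 0), A, E, F, D, B, C), (AF, (A, E, 0), A, F, E, D, B, C),
        (BD, (A, E, 1), E, A, D, F, B, C), (BE, (A, E, 2), A, E, F, D, B, C),
        (BF, (A, E, 2), A, F, E, D, B, C), (CD, (A, E, 1), E, A, D, F, C, B),
        (CE, (A, E, 2), A, E, F, D, C, B), (CF, (A, E, 2), A, F, E, D, C, B),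
        (DE, (A, E, 3), A, E, F, D, B, C), (DF, (A, E, 3), A, F, E, D, B, C)]),
      ([AD, BC], [], [AF, DF],
       [(AB, (A, B, 1), A, B, C, D, E, F), (AC, (A, B, 1), A, C, B, D, E, F),
        (AE, (A, B, 2), A, B, C, D, E, F), (AF, (A, B, 2), A, B, C, D, F, E),
        (BD, (A, B, 1), B, D, A, C, E, F), (BE, (A, B, 2), B, A, D, C, E, F),
        (BF, (A, B, 2), B, A, D, C, F, E), (CD, (A, B, 1), C, D, A, B, E, F),
        (CE, (A, B, 2), C, A, D, B, E, F), (CF, (A, B, 2), C, A, D, B, F, E),
        (DE, (A, B, 2), D, B, C, A, E, F), (DF, (A, B, 2), D, B, C, A, F, E),
        (EF, (A, B, 3), A, B, E, F, C, D)],
       [(AB, (A, E, 4), F, A, D, B, C, E), (AC, (A, E, 4), F, A, D, C, B, E),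
        (AE, (A, E, 5), F, A, D, B, C, E), (BD, (A, E, 4), F, D, A, B, C, E),
        (BE, (A, E, 6), F, A, D, B, C, E), (BF, (A, F, 0), F, A, D, B, C, E),
        (CD, (A, E, 4), F, D, A, C, B, E), (CE, (A, E, 6), F, A, D, C, B, E),
        (CF, (A, F, 0), F, A, D, C, B, E), (DE, (A, E, 5), F, D, A, B, C, E),
        (EF, (A, F, 1), F, A, D, B, C, E)]),
      ([CD, CE], [AB], [CF],
       [(AC, (A, B, 4), A, B, C, D, E, F), (AD, (A, B, 5), A, B, C, D, E, F),
        (AE, (A, B, 5), A, B, C, E, D, F), (AF, (A, B, 6), A, B, C, D, E, F),
        (BC, (A, B, 4), B, A, C, D, E, F), (BD, (A, B, 5), B, A, C, D, E, F),
        (BE, (A, B, 5), B, A, C, E, D, F), (BF, (A, B, 6), B, A, C, D, E, F),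
        (CF, (A, C, 0), A, B, C, D, E, F), (DF, (A, C, 1), A, B, C, D, F, E),
        (EF, (A, C, 1), A, B, C, E, F, D)],
       [(AC, (A, E, 0), C, A, B, F, D, E), (AD, (A, E, 2), C, A, B, F, D, E),
        (AE, (A, E, 2), C, A, B, F, E, D), (AF, (A, E, 3), C, A, B, F, D, E),
        (BC, (A, E, 0), C, B, A, F, D, E), (BD, (A, E, 2), C, B, A, F, D, E),
        (BE, (A, E, 2), C, B, A, F, E, D), (BF, (A, E, 3), C, B, A, F, D, E),
        (DF, (A, E, 1), A, C, F, B, D, E), (EF, (A, E, 1), A, C, F, B, E, D)]),
      ([AC, CD], [AB], [DF],
       [(AE, (A, C, 2), A, B, C, D, E, F), (AF, (A, C, 2), A, B, C, D, F, E),
        (BC, (A, C, 3), A, B, C, D, E, F), (BD, (A, C, 4), A, B, D, C, E, F),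
        (BE, (A, C, 5), B, A, C, D, E, F), (BF, (A, C, 5), B, A, C, D, F, E),
        (CE, (A, B, 4), A, B, C, D, E, F), (CF, (A, B, 4), A, B, C, D, F, E),
        (DE, (A, B, 5), A, B, D, C, E, F), (DF, (A, B, 5), A, B, D, C, F, E),
        (EF, (A, C, 6), A, B, C, E, F, D)],
       [(AE, (A, E, 2), A, D, F, B, C, E), (AF, (A, F, 2), A, D, F, B, C, E),
        (BC, (A, F, 3), D, A, B, F, C, E), (BD, (A, F, 2), D, A, B, F, C, E),
        (BE, (A, F, 4), D, B, A, F, C, E), (BF, (A, F, 5), A, D, F, B, C, E),
        (CE, (A, F, 6), A, D, F, B, C, E), (CF, (A, F, 3), A, D, F, B, C, E),
        (DE, (A, E, 2), D, A, B, F, C, E), (EF, (A, F, 4), A, F, D, B, C, E)]),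
      ([CF, DE], [AB], [EF],
       [(AC, (A, C, 6), A, B, C, D, E, F), (AD, (A, C, 6), A, B, D, C, F, E),
        (AE, (A, C, 6), A, B, E, C, F, D), (AF, (A, C, 6), A, B, F, D, E, C),
        (BC, (A, C, 6), B, A, C, D, E, F), (BD, (A, C, 6), B, A, D, C, F, E),
        (BE, (A, C, 6), B, A, E, C, F, D), (BF, (A, C, 6), B, A, F, D, E, C),
        (CD, (A, C, 1), A, B, C, D, E, F), (CE, (A, C, 1), A, B, C, E, D, F),
        (DF, (A, C, 1), A, B, D, F, C, E), (EF, (A, C, 1), A, B, E, F, C, D)],
       [(AC, (A, F, 4), A, E, F, B, C, D), (AD, (A, F, 4), A, F, E, B, D, C),
        (AE, (B, A, 0), A, E, F, B, C, D), (AF, (B, A, 0), A, F, E, B, D, C),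
        (BC, (A, F, 4), B, E, F, A, C, D), (BD, (A, F, 4), B, F, E, A, D, C),
        (BE, (B, A, 0), B, E, F, A, C, D), (BF, (B, A, 0), B, F, E, A, D, C),
        (CD, (B, A, 1), A, E, F, B, C, D), (CE, (A, E, 1), A, E, F, B, C, D),
        (DF, (A, E, 1), A, F, E, B, D, C)]),
      ([AE, CD], [AB], [BE],
       [(AC, (A, C, 2), A, B, C, D, E, F), (AD, (A, C, 2), A, B, D, C, E, F),
        (AF, (A, D, 0), A, B, C, D, E, F), (BC, (A, C, 5), A, B, C, D, E, F),
        (BD, (A, C, 5), A, B, D, C, E, F), (BE, (A, D, 1), A, B, C, D, E, F),
        (BF, (A, D, 2), A, B, C, D, F, E), (CE, (A, B, 5), A, B, C, E, D, F),
        (CF, (A, B, 6), A, B, C, D, F, E), (DE, (A, B, 5), A, B, D, E, C, F),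
        (DF, (A, B, 6), A, B, D, C, F, E), (EF, (A, C, 6), A, B, E, C, D, F)],
       [(AC, (A, E, 4), B, A, E, C, D, F), (AD, (A, E, 4), B, A, E, D, C, F),
        (AF, (A, E, 5), B, A, E, C, D, F), (BC, (A, F, 0), B, A, E, C, D, F),
        (BD, (A, F, 0), B, A, E, D, C, F), (BF, (A, F, 1), B, A, E, C, D, F),
        (CE, (A, E, 4), B, E, A, C, D, F), (CF, (A, E, 6), B, A, E, C, D, F),
        (DE, (A, E, 4), B, E, A, D, C, F), (DF, (A, E, 6), B, A, E, D, C, F),
        (EF, (A, E, 5), B, E, A, C, D, F)])]
   | (A, B) \<Rightarrow>
     [([AB, AC, AD], [], [AE, AF, CE, CF, DE, DF],
       [(BE, (A, D, 3), A, B, E, C, D, F), (BF, (A, D, 3), A, B, F, C, D, E),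
        (CE, (A, D, 3), A, C, E, B, D, F), (CF, (A, D, 3), A, C, F, B, D, E),
        (DE, (A, D, 3), A, D, E, B, C, F), (DF, (A, D, 3), A, D, F, B, C, E)],
       [(BE, (F, B, 1), E, F, A, C, D, B), (BF, (F, B, 1), F, E, A, C, D, B)]),
      ([AB, AD, BC], [], [AF, BE, CD, CE, DF, EF],
       [(AE, (A, D, 3), A, B, C, D, E, F), (AF, (A, D, 3), A, B, C, D, F, E),
        (BE, (A, D, 3), B, A, D, C, E, F), (BF, (A, D, 3), B, A, D, C, F, E),
        (CD, (A, D, 4), A, C, B, D, E, F), (CE, (A, D, 5), A, C, B, E, D, F),
        (CF, (A, D, 5), A, C, B, F, D, E), (DE, (A, D, 5), B, D, A, E, C, F),
        (DF, (A, D, 5), B, D, A, F, C, E), (EF, (A, D, 6), A, B, E, F, C, D)],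
       [(AE, (F, B, 2), E, F, D, C, A, B), (BF, (F, B, 2), F, E, C, D, B, A),
        (CF, (F, B, 3), F, E, C, D, B, A), (DE, (F, B, 3), E, F, D, C, A, B)]),
      ([AD, AE, BC], [], [AB, AC, BD, BE, CD, CE],
       [(AB, (A, D, 3), A, B, C, D, E, F), (AC, (A, D, 3), A, C, B, D, E, F),
        (BD, (A, D, 5), A, B, D, C, E, F), (BE, (A, D, 5), A, B, E, C, D, F),
        (CD, (A, D, 5), A, C, D, B, E, F), (CE, (A, D, 5), A, C, E, B, D, F),
        (DF, (A, D, 6), A, D, B, C, F, E), (EF, (A, D, 6), A, E, B, C, F, D)],
       [(DF, (F, B, 4), B, C, D, A, E, F), (EF, (F, B, 4), B, C, E, A, D, F)]),
      ([AF, BE, CD], [], [AB, AE, BF, EF],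
       [(AB, (A, D, 6), A, B, C, D, E, F), (AC, (A, D, 6), A, C, B, E, D, F),
        (AD, (A, D, 6), A, D, B, E, C, F), (AE, (A, D, 6), A, E, C, D, B, F),
        (BC, (A, D, 6), B, C, A, F, D, E), (BD, (A, D, 6), B, D, A, F, C, E),
        (BF, (A, D, 6), B, F, C, D, A, E), (CE, (A, D, 6), C, E, A, F, B, D),
        (CF, (A, D, 6), C, F, B, E, A, D), (DE, (A, D, 6), D, E, A, F, B, C),
        (DF, (A, D, 6), D, F, B, E, A, C), (EF, (A, D, 6), E, F, C, D, A, B)],
       [(AC, (E, A, 3), A, F, B, E, C, D), (AD, (E, A, 3), A, F, B, E, D, C),
        (BC, (E, A, 3), B, E, A, F, C, D), (BD, (E, A, 3), B, E, A, F, D, C),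
        (CE, (E, A, 3), E, B, A, F, C, D), (CF, (E, A, 3), F, A, B, E, C, D),
        (DE, (E, A, 3), E, B, A, F, D, C), (DF, (E, A, 3), F, A, B, E, D, C)]),
      ([AC, CD, CE], [AB], [AF, BC, BE, CF, EF],
       [(AF, (B, A, 2), A, B, C, D, E, F), (BC, (B, A, 3), A, B, C, D, E, F),
        (BD, (B, A, 4), B, A, C, D, E, F), (BE, (B, A, 4), B, A, C, E, D, F),
        (DF, (B, A, 5), A, B, C, D, F, E), (EF, (B, A, 5), A, B, C, E, F, D)],
       [(BD, (F, B, 1), B, F, C, A, E, D), (DF, (F, B, 1), F, B, C, A, E, D)]),
      ([AD, CD, CE], [AB], [AE, BD, BF, CF, EF],
       [(AE, (B, A, 6), A, B, C, D, E, F), (AF, (B, B, 0), A, B, C, D, E, F),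
        (BC, (B, A, 4), A, B, C, D, E, F), (BD, (B, B, 1), A, B, C, D, E, F),
        (BE, (B, B, 2), A, B, C, E, D, F), (BF, (B, B, 3), B, A, C, D, E, F),
        (CF, (B, B, 4), A, B, C, D, E, F), (DF, (B, A, 5), A, B, D, C, E, F),
        (EF, (B, B, 5), A, B, E, C, D, F)],
       [(AF, (F, B, 3), F, B, A, E, D, C), (BC, (F, B, 2), B, F, E, A, C, D),
        (BE, (F, B, 3), B, F, E, A, C, D), (DF, (F, B, 2), F, B, A, E, D, C)]),
      ([AF, CD, CE], [AB], [AC, BF, CF],
       [(AC, (B, A, 2), A, B, C, D, E, F), (AD, (B, B, 0), A, B, C, D, E, F),
        (AE, (B, B, 0), A, B, C, E, D, F), (BD, (B, B, 3), A, B, C, D, E, F),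
        (BE, (B, B, 3), A, B, C, E, D, F), (BF, (B, B, 6), A, B, C, D, E, F),
        (CF, (B, B, 4), A, B, C, F, D, E), (DF, (B, B, 5), A, B, C, D, F, E),
        (EF, (B, B, 5), A, B, C, E, F, D)],
       [(AD, (E, A, 1), C, B, A, F, D, E), (AE, (E, A, 1), C, B, A, F, E, D),
        (BD, (E, A, 2), C, B, A, F, D, E), (BE, (E, A, 2), C, B, A, F, E, D),
        (DF, (E, A, 1), C, B, F, A, D, E), (EF, (E, A, 1), C, B, F, A, E, D)])]
   | (A, C) \<Rightarrow>
     [([CD, CE, CF], [AB], [AD, BE, BF],
       [(AD, (B, B, 4), A, B, C, D, E, F), (AE, (B, B, 4), A, B, C, E, D, F),
        (AF, (B, B, 4), A, B, C, F, D, E), (BD, (B, B, 4), B, A, C, D, E, F),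
        (BE, (B, B, 4), B, A, C, E, D, F), (BF, (B, B, 4), B, A, C, F, D, E)],
       [(AC, (E, A, 4), B, A, D, E, F, C), (AE, (E, A, 5), B, A, D, E, F, C),
        (AF, (E, A, 5), B, A, D, F, E, C), (BC, (E, A, 6), B, A, D, E, F, C),
        (BD, (E, B, 0), B, A, D, E, F, C)]),
      ([CD, CF, DE], [AB], [AD, AE, BC, BF, EF],
       [(AC, (B, A, 5), A, B, C, D, E, F), (AD, (B, A, 5), A, B, D, C, F, E),
        (AE, (B, B, 5), A, B, C, D, E, F), (AF, (B, B, 5), A, B, D, C, F, E),
        (BC, (B, A, 5), B, A, C, D, E, F), (BD, (B, A, 5), B, A, D, C, F, E),
        (BE, (B, B, 5), B, A, C, D, E, F), (BF, (B, B, 5), B, A, D, C, F, E),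
        (EF, (B, C, 0), A, B, C, E, D, F)],
       [(AC, (F, B, 2), A, B, F, E, C, D), (AF, (F, B, 3), A, B, F, E, C, D),
        (BD, (F, B, 2), B, A, E, F, D, C), (BE, (F, B, 3), B, A, E, F, D, C)]),
      ([AC, AE, CD], [AB], [BE, BF, CF, DE, DF],
       [(AF, (B, C, 1), A, B, C, D, E, F), (BC, (B, C, 2), A, B, C, D, E, F),
        (BD, (B, C, 3), A, B, D, C, E, F), (BE, (B, C, 4), A, B, C, D, E, F),
        (BF, (B, C, 5), A, B, C, D, F, E), (CF, (B, A, 2), A, B, C, D, F, E),
        (DE, (B, A, 6), A, B, D, C, E, F), (DF, (B, B, 0), A, B, D, C, F, E),
        (EF, (B, C, 6), A, B, C, E, F, D)],
       [(AF, (F, B, 2), F, B, E, D, A, C), (BC, (F, B, 2), B, F, D, E, C, A),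
        (BD, (F, B, 3), B, F, D, E, C, A), (EF, (F, B, 3), F, B, E, D, A, C)]),
      ([AC, BC, CD], [AB], [CE, CF, DE, DF],
       [(AE, (B, C, 2), A, B, C, D, E, F), (AF, (B, C, 2), A, B, C, D, F, E),
        (BE, (B, C, 2), B, A, C, D, E, F), (BF, (B, C, 2), B, A, C, D, F, E),
        (CE, (B, A, 3), A, B, C, D, E, F), (CF, (B, A, 3), A, B, C, D, F, E),
        (DE, (B, B, 1), A, B, D, C, E, F), (DF, (B, B, 1), A, B, D, C, F, E),
        (EF, (B, D, 0), A, B, C, E, F, D)],
       [(AE, (E, E, 4), C, D, A, B, E, F), (AF, (E, E, 4), C, D, A, B, F, E),
        (BE, (E, E, 4), C, D, B, A, E, F), (BF, (E, E, 4), C, D, B, A, F, E),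
        (EF, (E, E, 5), C, D, A, B, E, F)]),
      ([AD, BC, CD], [AB], [AF, BE, CE, DF, EF],
       [(AE, (B, C, 3), A, B, C, D, E, F), (AF, (B, C, 3), A, B, C, D, F, E),
        (BE, (B, C, 3), B, A, D, C, E, F), (BF, (B, C, 3), B, A, D, C, F, E),
        (CE, (B, A, 4), A, B, C, D, E, F), (CF, (B, A, 4), A, B, C, D, F, E),
        (DE, (B, A, 4), B, A, D, C, E, F), (DF, (B, A, 4), B, A, D, C, F, E),
        (EF, (B, D, 1), A, B, C, E, F, D)],
       [(AE, (F, B, 3), E, F, A, B, D, C), (BF, (F, B, 3), F, E, B, A, C, D),
        (CF, (F, B, 2), F, E, B, A, C, D), (DE, (F, B, 2), E, F, A, B, D, C)]),
      ([AE, BC, CD], [AB], [AC, AD, BE, CE, DE],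
       [(AC, (B, C, 2), A, B, C, D, E, F), (AD, (B, C, 3), A, B, C, D, E, F),
        (BE, (B, C, 4), B, A, C, D, E, F), (BF, (B, C, 5), B, A, C, D, E, F),
        (CE, (B, A, 4), A, B, C, E, D, F), (DE, (B, B, 2), A, B, D, C, E, F),
        (DF, (B, B, 3), A, B, D, C, F, E)],
       [(BF, (F, B, 4), A, E, B, C, D, F), (DF, (F, B, 4), A, E, D, C, B, F)]),
      ([AC, CF, DE], [AB], [CD, CE, DF, EF],
       [(AD, (B, C, 6), A, B, C, D, E, F), (AE, (B, C, 6), A, B, C, E, D, F),
        (BC, (B, D, 0), A, B, C, D, E, F), (BF, (B, D, 1), A, B, F, D, E, C),
        (CD, (B, A, 5), A, B, C, D, E, F), (CE, (B, A, 5), A, B, C, E, D, F),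
        (DF, (B, B, 5), A, B, D, F, C, E), (EF, (B, B, 5), A, B, E, F, C, D)],
       [(AD, (E, E, 6), C, F, A, B, D, E), (AE, (E, E, 6), C, F, A, B, E, D),
        (BC, (E, E, 5), C, F, A, B, D, E), (BF, (E, F, 0), F, C, A, B, D, E)])]
   | (A, D) \<Rightarrow>
     [([AE, AF, CD], [AB], [BE, BF, CF, DF],
       [(AC, (B, C, 1), A, B, C, D, E, F), (AD, (B, C, 1), A, B, D, C, E, F),
        (BE, (B, D, 2), A, B, C, D, E, F), (BF, (B, D, 2), A, B, C, D, F, E),
        (CE, (B, B, 0), A, B, C, E, D, F), (CF, (B, B, 0), A, B, C, F, D, E),
        (DE, (B, B, 0), A, B, D, E, C, F), (DF, (B, B, 0), A, B, D, F, C, E)],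
       [(AC, (E, E, 2), F, B, A, E, C, D), (AD, (E, E, 2), F, B, A, E, D, C),
        (CE, (E, E, 3), F, B, E, A, C, D), (DE, (E, E, 3), F, B, E, A, D, C)]),
      ([AE, BE, CD], [AB], [CE, DE],
       [(AC, (B, C, 4), A, B, C, D, E, F), (AD, (B, C, 4), A, B, D, C, E, F),
        (AF, (B, D, 2), A, B, C, D, E, F), (BC, (B, C, 4), B, A, C, D, E, F),
        (BD, (B, C, 4), B, A, D, C, E, F), (BF, (B, D, 2), B, A, C, D, E, F),
        (CE, (B, B, 1), A, B, C, E, D, F), (CF, (B, B, 6), A, B, C, D, F, E),
        (DE, (B, B, 1), A, B, D, E, C, F), (DF, (B, B, 6), A, B, D, C, F, E),
        (EF, (B, D, 0), A, B, E, C, D, F)],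
       [(AC, (D, A, 3), E, A, B, C, D, F), (AD, (D, A, 3), E, A, B, D, C, F),
        (AF, (D, A, 4), E, A, B, C, D, F), (BC, (D, A, 3), E, B, A, C, D, F),
        (BD, (D, A, 3), E, B, A, D, C, F), (BF, (D, A, 4), E, B, A, C, D, F),
        (CF, (D, A, 5), E, A, B, C, D, F), (DF, (D, A, 5), E, A, B, D, C, F),
        (EF, (D, A, 6), E, A, B, C, D, F)]),
      ([AF, BE, CD], [AB], [AE, BF, EF],
       [(AC, (B, C, 5), A, B, C, D, E, F), (AD, (B, C, 5), A, B, D, C, E, F),
        (AE, (B, D, 2), A, B, C, D, E, F), (BC, (B, C, 5), B, A, C, D, F, E),
        (BD, (B, C, 5), B, A, D, C, F, E), (BF, (B, D, 2), B, A, C, D, F, E),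
        (CE, (B, B, 3), A, B, C, E, D, F), (CF, (B, B, 3), B, A, C, F, D, E),
        (DE, (B, B, 3), A, B, D, E, C, F), (DF, (B, B, 3), B, A, D, F, C, E),
        (EF, (B, D, 1), A, B, E, C, D, F)],
       [(AC, (E, A, 3), A, F, B, E, C, D), (AD, (E, A, 3), A, F, B, E, D, C),
        (BC, (E, A, 3), B, E, A, F, C, D), (BD, (E, A, 3), B, E, A, F, D, C),
        (CE, (E, A, 3), E, B, A, F, C, D), (CF, (E, A, 3), F, A, B, E, C, D),
        (DE, (E, A, 3), E, B, A, F, D, C), (DF, (E, A, 3), F, A, B, E, D, C)]),
      ([AB, AD, AE, BC], [], [AF, BE, CD, CE, DF, EF],
       [(CD, (B, D, 3), A, C, B, D, E, F), (CE, (B, D, 3), A, C, B, E, D, F),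
        (DF, (B, D, 4), A, B, D, F, C, E), (EF, (B, D, 4), A, B, E, F, C, D)],
       []),
      ([AC, AD, BC, BD], [], [AE, BF, CE, DF, EF],
       [(AE, (B, D, 3), A, B, C, D, E, F), (AF, (B, D, 3), A, B, C, D, F, E),
        (BE, (B, D, 3), B, A, C, D, E, F), (BF, (B, D, 3), B, A, C, D, F, E),
        (CE, (B, D, 3), C, D, A, B, E, F), (CF, (B, D, 3), C, D, A, B, F, E),
        (DE, (B, D, 3), D, C, A, B, E, F), (DF, (B, D, 3), D, C, A, B, F, E)],
       [(AF, (F, B, 5), F, E, A, C, B, D), (BE, (F, B, 5), E, F, B, D, A, C),
        (CF, (F, B, 5), F, E, C, A, D, B), (DE, (F, B, 5), E, F, D, B, C, A)]),
      ([AC, AE, BC, BD], [], [AB, AD, AF, BE, CF, DE, EF],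
       [(AD, (B, D, 3), A, B, C, D, E, F), (BE, (B, D, 3), B, A, C, E, D, F),
        (CF, (B, D, 4), C, A, B, D, E, F)],
       []),
      ([AB, AF, BE, CD], [], [AC, AD, BC, BD],
       [(AC, (B, D, 4), A, B, C, D, E, F), (AD, (B, D, 4), A, B, D, C, E, F),
        (BC, (B, D, 4), B, A, C, D, F, E), (BD, (B, D, 4), B, A, D, C, F, E)],
       [])]
   | (A, E) \<Rightarrow>
     [([AB, AE, AF], [AD, BC], [AC, BD, CF, DF],
       [(AC, (B, D, 5), A, B, C, D, E, F), (BD, (B, D, 6), A, B, C, D, E, F),
        (CE, (B, E, 0), A, C, B, D, E, F), (CF, (B, E, 0), A, C, B, D, F, E),
        (DE, (B, E, 1), B, A, D, C, E, F), (DF, (B, E, 1), B, A, D, C, F, E)],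
       [(CE, (F, B, 1), C, D, A, B, F, E), (DE, (F, B, 1), D, C, A, B, F, E)]),
      ([BE, BF, CE], [AD, BC], [CF],
       [(AB, (B, E, 1), A, B, C, D, E, F), (AC, (B, E, 2), A, B, C, D, E, F),
        (AE, (B, E, 3), A, B, C, D, E, F), (AF, (B, E, 4), A, B, C, D, E, F),
        (BD, (B, E, 1), D, B, C, A, E, F), (CD, (B, E, 2), D, B, C, A, E, F),
        (CF, (B, E, 5), A, B, C, D, E, F), (DE, (B, E, 3), D, B, C, A, E, F),
        (DF, (B, E, 4), D, B, C, A, E, F)],
       [(AB, (C, F, 6), C, A, D, B, F, E), (AC, (D, A, 0), C, A, D, B, F, E),
        (AE, (D, A, 1), C, A, D, B, F, E), (AF, (D, A, 2), C, A, D, B, F, E),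
        (BD, (C, F, 6), C, D, A, B, F, E), (CD, (D, A, 0), C, D, A, B, F, E),
        (DE, (D, A, 1), C, D, A, B, F, E), (DF, (D, A, 2), C, D, A, B, F, E)]),
      ([AE, AF, BE], [AD, BC], [BF, CD, CE, DF],
       [(AC, (B, E, 0), A, B, C, D, E, F), (BD, (B, E, 6), A, B, C, D, E, F),
        (BF, (B, F, 0), A, B, C, D, E, F), (CD, (B, F, 1), A, B, C, D, E, F),
        (CE, (B, F, 2), A, B, C, D, E, F), (CF, (B, F, 3), A, B, C, D, F, E),
        (DE, (B, E, 3), B, A, D, C, E, F), (DF, (B, E, 4), B, A, D, C, F, E)],
       [(AC, (F, B, 2), C, D, F, B, A, E), (BD, (F, B, 3), D, C, B, F, E, A),
        (CF, (F, B, 3), C, D, F, B, A, E), (DE, (F, B, 2), D, C, B, F, E, A)]),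
      ([AE, AF, BD], [AD, BC], [AB, CD],
       [(AB, (B, D, 6), A, B, C, D, E, F), (BE, (B, E, 6), A, B, C, D, E, F),
        (BF, (B, E, 6), A, B, C, D, F, E), (CD, (B, F, 4), A, B, C, D, E, F),
        (CE, (B, F, 1), A, C, B, D, E, F), (CF, (B, F, 1), A, C, B, D, F, E),
        (DE, (B, E, 2), B, A, D, C, E, F), (DF, (B, E, 2), B, A, D, C, F, E)],
       [(BE, (E, A, 1), A, C, B, D, E, F), (BF, (E, A, 1), A, C, B, D, F, E),
        (CE, (E, A, 2), A, C, B, D, E, F), (CF, (E, A, 2), A, C, B, D, F, E),
        (DE, (E, A, 1), A, C, D, B, E, F), (DF, (E, A, 1), A, C, D, B, F, E)]),
      ([BC, BD, DE], [AB, AC], [AF, CE, DF, EF],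
       [(AD, (B, F, 5), A, B, C, D, E, F), (AE, (B, F, 6), A, B, C, D, E, F),
        (AF, (C, A, 0), A, B, C, D, E, F), (BF, (C, A, 1), A, B, C, D, E, F),
        (CE, (C, A, 2), A, B, C, E, D, F), (CF, (C, A, 3), A, C, B, D, E, F),
        (DF, (C, A, 4), A, B, C, D, E, F), (EF, (C, A, 5), A, B, C, E, D, F)],
       [(AD, (F, B, 2), A, F, E, C, D, B), (AE, (F, B, 3), A, F, E, C, D, B),
        (BF, (F, B, 2), F, A, C, E, B, D), (CF, (F, B, 3), F, A, C, E, B, D)]),
      ([BC, BF, DE], [AB, AC], [AF, DF, EF],
       [(AF, (C, A, 6), A, B, C, D, E, F), (BD, (C, A, 1), A, B, C, D, E, F),
        (BE, (C, A, 1), A, B, C, E, D, F), (CD, (C, A, 3), A, B, C, D, E, F),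
        (CE, (C, A, 3), A, B, C, E, D, F), (DF, (C, A, 5), A, B, C, D, F, E),
        (EF, (C, A, 5), A, B, C, E, F, D)],
       [(BD, (E, E, 2), F, A, B, C, D, E), (BE, (E, E, 2), F, A, B, C, E, D),
        (CD, (E, E, 3), F, A, C, B, D, E), (CE, (E, E, 3), F, A, C, B, E, D)]),
      ([BC, DE, DF], [AB, AC], [BD, CD],
       [(AE, (C, B, 0), A, B, C, D, E, F), (AF, (C, B, 0), A, B, C, D, F, E),
        (BD, (C, A, 4), A, B, C, D, E, F), (BE, (C, A, 5), A, B, C, D, E, F),
        (BF, (C, A, 5), A, B, C, D, F, E), (CD, (C, A, 4), A, C, B, D, E, F),
        (CE, (C, A, 5), A, C, B, D, E, F), (CF, (C, A, 5), A, C, B, D, F, E)],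
       [(AE, (E, A, 2), D, A, B, C, E, F), (AF, (E, A, 2), D, A, B, C, F, E),
        (BE, (E, A, 1), D, A, B, C, E, F), (BF, (E, A, 1), D, A, B, C, F, E),
        (CE, (E, A, 1), D, A, C, B, E, F), (CF, (E, A, 1), D, A, C, B, F, E)])]
   | (A, F) \<Rightarrow>
     [([AD, BC, DE], [AB, AC], [BD, BE, CD, CE],
       [(AF, (C, B, 1), A, B, C, D, E, F), (BD, (B, F, 5), A, B, C, D, E, F),
        (BE, (B, F, 6), A, B, C, E, D, F), (CD, (B, F, 5), A, C, B, D, E, F),
        (CE, (B, F, 6), A, C, B, E, D, F), (EF, (C, B, 0), A, B, C, E, D, F)],
       [(AF, (F, B, 4), B, C, A, D, E, F), (EF, (F, B, 4), B, C, E, D, A, F)]),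
      ([AF, BC, DE], [AB, AC], [BF, CF],
       [(AD, (C, B, 1), A, B, C, D, E, F), (AE, (C, B, 1), A, B, C, E, D, F),
        (BD, (C, A, 0), A, B, C, D, E, F), (BE, (C, A, 0), A, B, C, E, D, F),
        (BF, (C, A, 6), A, B, C, D, E, F), (CD, (C, A, 0), A, C, B, D, E, F),
        (CE, (C, A, 0), A, C, B, E, D, F), (CF, (C, A, 6), A, C, B, D, E, F),
        (DF, (C, B, 0), A, B, C, D, F, E), (EF, (C, B, 0), A, B, C, E, F, D)],
       [(AD, (E, A, 3), A, F, B, C, D, E), (AE, (E, A, 3), A, F, B, C, E, D),
        (BD, (E, A, 3), B, C, A, F, D, E), (BE, (E, A, 3), B, C, A, F, E, D),
        (CD, (E, A, 3), C, B, A, F, D, E), (CE, (E, A, 3), C, B, A, F, E, D),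
        (DF, (E, A, 3), F, A, B, C, D, E), (EF, (E, A, 3), F, A, B, C, E, D)]),
      ([AC, AE, BE], [AD, BC], [BF, CD, DF, EF],
       [(AF, (B, E, 0), A, B, C, D, E, F), (BD, (C, B, 2), A, B, C, D, E, F),
        (BF, (B, E, 6), B, A, D, C, E, F), (CD, (C, B, 3), A, B, C, D, E, F),
        (CF, (C, B, 4), A, C, B, D, E, F), (DE, (C, B, 5), B, A, D, C, E, F),
        (DF, (C, B, 6), B, A, D, C, F, E), (EF, (C, C, 0), A, B, C, D, E, F)],
       [(AF, (F, B, 2), F, D, C, B, A, E), (BD, (F, B, 3), D, F, B, C, E, A),
        (CF, (F, B, 3), F, D, C, B, A, E), (DE, (F, B, 2), D, F, B, C, E, A)]),
      ([AE, BE, CE], [AD, BC], [AF, DE, EF],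
       [(AF, (B, F, 2), A, B, C, D, E, F), (BD, (C, B, 5), A, B, C, D, E, F),
        (BF, (B, E, 3), A, B, C, D, E, F), (CD, (C, B, 5), A, C, B, D, E, F),
        (CF, (B, E, 3), A, C, B, D, E, F), (DE, (C, C, 1), A, B, C, D, E, F),
        (DF, (C, C, 2), D, B, C, A, E, F), (EF, (C, C, 3), A, B, C, D, E, F)],
       [(BD, (E, E, 4), E, A, B, C, D, F), (BF, (E, E, 4), E, A, B, C, F, D),
        (CD, (E, E, 4), E, A, C, B, D, F), (CF, (E, E, 4), E, A, C, B, F, D),
        (DF, (E, E, 5), E, A, B, C, D, F)]),
      ([AE, BF, CE], [AD, BC], [CD, CF, DE],
       [(AB, (C, B, 4), A, B, C, D, E, F), (AF, (B, F, 3), A, B, C, D, E, F),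
        (BE, (B, E, 3), A, B, C, D, E, F), (CD, (C, B, 6), A, C, B, D, F, E),
        (CF, (B, E, 4), A, C, B, D, F, E), (DE, (C, C, 2), B, A, D, C, E, F),
        (EF, (C, C, 4), A, B, C, D, E, F)],
       [(AB, (E, E, 3), C, D, A, E, B, F), (AF, (E, E, 3), C, D, A, E, F, B),
        (BE, (E, E, 2), C, D, E, A, B, F), (EF, (E, E, 2), C, D, E, A, F, B)]),
      ([AE, BE, CD], [AD, BC], [AC, BD, CE, DE],
       [(AC, (C, B, 3), A, B, C, D, E, F), (AF, (B, F, 1), A, B, C, D, E, F),
        (BD, (C, B, 3), B, A, D, C, E, F), (BF, (B, F, 1), B, A, D, C, E, F),
        (CE, (C, B, 5), A, C, B, D, E, F), (DE, (C, B, 5), B, D, A, C, E, F)],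
       [(AF, (F, B, 4), C, D, A, E, B, F), (BF, (F, B, 4), C, D, B, E, A, F)]),
      ([AE, BE, EF], [AD, BC], [AC, BD, CE, DE],
       [(AC, (C, C, 0), A, B, C, D, E, F), (BD, (C, C, 0), B, A, D, C, E, F),
        (CE, (C, C, 3), A, B, C, D, E, F), (CF, (C, C, 4), A, C, B, D, E, F),
        (DE, (C, C, 3), B, A, D, C, E, F), (DF, (C, C, 4), B, D, A, C, E, F)],
       [(CF, (F, B, 1), C, D, E, A, B, F), (DF, (F, B, 1), D, C, E, A, B, F)])]
   | (B, A) \<Rightarrow>
     [([AB, BF, CE], [AD, BC], [BE, CF, EF],
       [(AC, (C, C, 5), A, B, C, D, E, F), (AE, (C, B, 4), A, B, C, D, E, F),
        (BD, (C, C, 6), A, B, C, D, E, F), (BE, (B, E, 1), A, B, C, D, E, F),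
        (CF, (B, E, 2), A, C, B, D, F, E), (DF, (C, B, 6), D, B, C, A, E, F),
        (EF, (C, D, 0), A, B, C, D, E, F)],
       [(AC, (E, E, 6), B, F, A, D, C, E), (AE, (E, E, 6), B, F, A, D, E, C),
        (BD, (E, E, 5), B, F, A, D, C, E), (DF, (E, F, 0), F, B, A, D, C, E)]),
      ([BF, CE, EF], [AD, BC], [AC, AE, BD, DF],
       [(AB, (C, D, 0), A, B, C, D, E, F), (AC, (C, D, 0), A, C, B, D, F, E),
        (AE, (C, C, 4), A, B, C, D, E, F), (AF, (C, C, 4), A, C, B, D, F, E),
        (BD, (C, D, 0), D, B, C, A, E, F), (CD, (C, D, 0), D, C, B, A, F, E),
        (DE, (C, C, 4), D, B, C, A, E, F), (DF, (C, C, 4), D, C, B, A, F, E)],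
       [(AB, (F, B, 3), A, D, B, C, F, E), (AF, (F, B, 2), A, D, B, C, F, E),
        (CD, (F, B, 3), D, A, C, B, E, F), (DE, (F, B, 2), D, A, C, B, E, F)]),
      ([AC, AF, CD, CE], [AB], [BC, BD, BE, DF, EF],
       [(BD, (C, D, 1), A, B, C, D, E, F), (BE, (C, D, 1), A, B, C, E, D, F),
        (DF, (C, D, 2), A, B, C, D, F, E), (EF, (C, D, 2), A, B, C, E, F, D)],
       []),
      ([AC, BC, CD, CE], [AB], [CF, DF, EF],
       [(DF, (C, D, 3), A, B, C, D, F, E), (EF, (C, D, 3), A, B, C, E, F, D)],
       []),
      ([AD, BC, CD, CE], [AB], [AE, BF, CF, DE, EF],
       [(AE, (C, D, 4), A, B, C, D, E, F), (BF, (C, D, 1), B, A, C, D, E, F),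
        (EF, (C, D, 5), A, B, C, E, F, D)],
       []),
      ([AC, CD, CF, DE], [AB], [AE, BC, BF, CE, DF, EF],
       [(AE, (C, D, 2), A, B, C, D, E, F), (BC, (C, D, 3), A, B, C, D, E, F),
        (BF, (C, D, 5), B, A, C, D, E, F), (EF, (C, D, 6), A, B, C, E, D, F)],
       []),
      ([AD, AE, CD, CE], [AB], [BD, BF, CF, EF],
       [(AF, (C, E, 0), A, B, C, D, E, F), (BC, (C, D, 4), A, B, C, D, E, F),
        (BD, (C, E, 1), A, B, C, D, E, F), (BE, (C, E, 1), A, B, C, E, D, F),
        (CF, (C, E, 2), A, B, C, D, E, F), (DF, (C, D, 2), A, B, D, C, E, F),
        (EF, (C, D, 2), A, B, E, C, D, F)],
       [(AF, (F, B, 5), F, B, A, D, C, E), (BC, (F, B, 5), B, F, C, E, A, D),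
        (BE, (F, B, 5), B, F, E, C, D, A), (DF, (F, B, 5), F, B, D, A, E, C)])]
   | (B, B) \<Rightarrow>
     [([AD, AF, CD, CE], [AB], [AC, AE, BD, BF, CF, EF],
       [(AE, (C, E, 0), A, B, C, D, E, F), (BD, (C, E, 3), A, B, C, D, E, F),
        (BF, (C, E, 4), A, B, C, D, E, F), (CF, (C, E, 2), A, B, C, D, F, E)],
       []),
      ([AD, BD, CD, CE], [AB], [AE, BF, CF, EF],
       [(AE, (C, E, 1), A, B, C, D, E, F), (AF, (C, E, 3), A, B, C, D, E, F),
        (BE, (C, E, 1), B, A, C, D, E, F), (BF, (C, E, 3), B, A, C, D, E, F),
        (CF, (C, E, 5), A, B, C, D, E, F), (DF, (C, D, 3), A, B, D, C, E, F),
        (EF, (C, E, 6), A, B, E, C, D, F)],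
       [(AF, (F, C, 1), F, A, B, E, C, D), (BE, (F, C, 0), F, A, B, E, C, D),
        (DF, (F, C, 2), F, A, B, E, C, D)]),
      ([AE, BD, CD, CE], [AB], [AD, BE, CF],
       [(AD, (C, E, 1), A, B, C, D, E, F), (BE, (C, E, 1), B, A, C, E, D, F),
        (CF, (C, F, 0), A, B, C, D, E, F)],
       []),
      ([AF, BD, CD, CE], [AB], [AC, AD, BF, CF, DF],
       [(AC, (C, D, 1), A, B, C, D, E, F), (AD, (C, E, 3), A, B, C, D, E, F),
        (BF, (C, E, 4), B, A, C, D, E, F), (CF, (C, F, 0), A, B, C, D, F, E),
        (DF, (C, D, 5), A, B, D, C, E, F)],
       []),
      ([AD, CD, CE, CF], [AB], [AC, AE, AF, BD],
       [(AE, (C, E, 2), A, B, C, D, E, F), (AF, (C, E, 2), A, B, C, D, F, E),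
        (BD, (C, E, 5), A, B, C, D, E, F), (BE, (C, F, 0), A, B, C, E, D, F),
        (BF, (C, F, 0), A, B, C, F, D, E)],
       [(BE, (F, B, 6), A, B, D, C, E, F), (BF, (F, B, 6), A, B, D, C, F, E)]),
      ([AE, CD, CF, DE], [AB], [AC, AF, BD, BE, CE, EF],
       [(AC, (C, D, 2), A, B, C, D, E, F), (BD, (C, D, 5), A, B, D, C, F, E),
        (BE, (C, E, 6), A, B, C, D, E, F), (EF, (C, D, 6), A, B, E, C, D, F)],
       []),
      ([AF, BF, CD, CE], [AB], [CF, DF, EF],
       [(AD, (C, E, 4), A, B, C, D, E, F), (AE, (C, E, 4), A, B, C, E, D, F),
        (BD, (C, E, 4), B, A, C, D, E, F), (BE, (C, E, 4), B, A, C, E, D, F),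
        (CF, (C, E, 5), A, B, C, F, D, E), (DF, (C, E, 6), A, B, C, D, F, E),
        (EF, (C, E, 6), A, B, C, E, F, D)],
       [(AD, (E, F, 3), F, A, B, C, D, E), (AE, (E, F, 3), F, A, B, C, E, D),
        (BD, (E, F, 3), F, B, A, C, D, E), (BE, (E, F, 3), F, B, A, C, E, D)])]
   | (B, C) \<Rightarrow>
     [([CE, CF, DE, DF], [AB], [AC, AE, BD, BF],
       [(AC, (C, D, 6), A, B, C, D, E, F), (AD, (C, D, 6), A, B, D, C, E, F),
        (AE, (C, D, 6), A, B, E, F, C, D), (AF, (C, D, 6), A, B, F, E, C, D),
        (BC, (C, D, 6), B, A, C, D, E, F), (BD, (C, D, 6), B, A, D, C, E, F),
        (BE, (C, D, 6), B, A, E, F, C, D), (BF, (C, D, 6), B, A, F, E, C, D)],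
       [(AD, (F, B, 5), A, B, D, F, C, E), (AF, (F, B, 5), A, B, F, D, E, C),
        (BC, (F, B, 5), B, A, C, E, D, F), (BE, (F, B, 5), B, A, E, C, F, D)]),
      ([AC, AE, AF, CD], [AB], [BC, BE, BF, DE, DF],
       [(BE, (C, F, 1), A, B, C, D, E, F), (BF, (C, F, 1), A, B, C, D, F, E),
        (DE, (C, E, 0), A, B, D, C, E, F), (DF, (C, E, 0), A, B, D, C, F, E)],
       []),
      ([AC, AE, BC, CD], [AB], [AD, BE, BF, CF, DE, DF],
       [(BE, (C, F, 2), A, B, C, D, E, F), (BF, (C, F, 3), A, B, C, D, F, E),
        (DE, (C, E, 1), A, B, D, C, E, F), (DF, (C, E, 3), A, B, D, C, F, E)],
       []),
      ([AD, AE, BC, CD], [AB], [AC, AF, BE, CE, DF, EF],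
       [(BE, (C, F, 4), A, B, C, D, E, F), (CE, (C, D, 4), A, B, C, D, E, F),
        (DF, (C, D, 1), A, B, D, C, F, E)],
       []),
      ([AC, AE, BE, CD], [AB], [AF, BC, BD, CF, DE, DF],
       [(AF, (C, F, 1), A, B, C, D, E, F), (BC, (C, F, 2), A, B, C, D, E, F),
        (BD, (C, F, 4), A, B, D, C, E, F), (DE, (C, E, 1), A, B, D, E, C, F),
        (DF, (C, E, 4), A, B, D, C, F, E)],
       []),
      ([AC, AF, BE, CD], [AB], [AE, BC, BF, CE, EF],
       [(AE, (C, F, 1), A, B, C, D, E, F), (BC, (C, F, 3), A, B, C, D, E, F),
        (CE, (C, D, 1), A, B, C, E, D, F)],
       []),
      ([AC, AD, CF, DE], [AB], [BC, BF, CD, CE, DF, EF],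
       [(CE, (C, D, 2), A, B, C, E, D, F), (DF, (C, D, 2), A, B, D, F, C, E)],
       [])]
   | (B, D) \<Rightarrow>
     [([AC, BC, CF, DE], [AB], [BD, BE, CD, CE, DF, EF],
       [(CD, (C, D, 3), A, B, C, D, E, F), (CE, (C, D, 3), A, B, C, E, D, F),
        (DF, (C, E, 6), A, B, D, F, C, E), (EF, (C, E, 6), A, B, E, F, C, D)],
       []),
      ([AF, BC, CF, DE], [AB], [BD, BE, CD, CE, DF, EF],
       [(CD, (C, D, 5), A, B, C, D, E, F), (CE, (C, D, 5), A, B, C, E, D, F),
        (DF, (C, D, 5), B, A, F, D, E, C), (EF, (C, D, 5), B, A, F, E, D, C)],
       []),
      ([AE, AF, BE, CD], [AB], [AD, BF, CE, DF],
       [(AC, (C, F, 1), A, B, C, D, E, F), (AD, (C, F, 1), A, B, D, C, E, F),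
        (BF, (C, F, 5), A, B, C, D, E, F), (CE, (C, E, 3), A, B, C, E, D, F),
        (CF, (C, E, 4), A, B, C, F, D, E), (DE, (C, E, 3), A, B, D, E, C, F),
        (DF, (C, E, 4), A, B, D, F, C, E)],
       [(AC, (F, C, 3), A, F, C, E, B, D), (CF, (F, C, 4), A, F, C, E, B, D),
        (DE, (F, C, 5), A, F, E, C, D, B)]),
      ([AC, AD, AE, BC, BD], [], [AF, BF, CF, DF],
       [],
       []),
      ([AB, AC, AF, BE, CD], [], [AD, AE, CE, DF, EF],
       [],
       []),
      ([AB, AC, AE, AF], [AD, BC], [CD, DE, DF],
       [(DE, (D, B, 0), B, A, D, C, E, F), (DF, (D, B, 0), B, A, D, C, F, E)],
       []),
      ([AB, AE, AF, BD], [AD, BC], [CD, DE, DF],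
       [(CE, (D, B, 1), A, C, B, D, E, F), (CF, (D, B, 1), A, C, B, D, F, E),
        (DE, (D, B, 2), B, A, D, C, E, F), (DF, (D, B, 2), B, A, D, C, F, E)],
       [(CE, (F, B, 6), D, C, B, A, E, F), (CF, (F, B, 6), D, C, B, A, F, E)])]
   | (B, E) \<Rightarrow>
     [([AC, AE, AF, BE], [AD, BC], [BF, CD, DF],
       [(BF, (D, B, 3), A, B, C, D, E, F), (CD, (D, B, 1), A, B, C, D, E, F),
        (DF, (D, B, 4), B, A, D, C, F, E)],
       []),
      ([AB, BE, BF, CE], [AD, BC], [AC, BD, CF, DF],
       [(AC, (D, B, 2), A, B, C, D, E, F), (BD, (D, B, 0), A, B, C, D, E, F),
        (CF, (D, B, 5), A, B, C, D, E, F), (DF, (D, B, 4), D, B, C, A, E, F)],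
       []),
      ([AC, BE, BF, CE], [AD, BC], [AB, AF, CD, CF, DE],
       [(AB, (D, B, 2), A, B, C, D, E, F), (AF, (D, B, 6), A, B, C, D, E, F),
        (CD, (D, C, 0), A, B, C, D, E, F), (CF, (D, B, 5), A, C, B, D, E, F),
        (DE, (D, C, 1), D, B, C, A, E, F)],
       []),
      ([AE, BE, BF, CE], [AD, BC], [AF, CD, CF, DE, EF],
       [(AF, (D, C, 2), A, B, C, D, E, F), (CD, (D, C, 1), A, B, C, D, E, F),
        (CF, (D, C, 3), A, B, C, D, E, F), (DE, (D, C, 4), B, A, D, C, E, F)],
       []),
      ([AF, BE, BF, CE], [AD, BC], [AC, AE, BD, CF, DF],
       [(AC, (D, B, 6), A, B, C, D, E, F), (AE, (D, C, 2), A, B, C, D, E, F),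
        (BD, (D, B, 4), A, B, C, D, E, F), (CF, (D, C, 3), A, B, C, D, F, E),
        (DF, (D, C, 5), B, A, D, C, E, F)],
       []),
      ([BE, BF, CE, CF], [AD, BC], [AB, CD],
       [(AB, (D, B, 5), A, B, C, D, E, F), (AC, (D, B, 5), A, C, B, D, E, F),
        (AE, (D, C, 3), A, B, C, D, E, F), (AF, (D, C, 3), A, B, C, D, F, E),
        (BD, (D, B, 5), D, B, C, A, E, F), (CD, (D, B, 5), D, C, B, A, E, F),
        (DE, (D, C, 3), D, B, C, A, E, F), (DF, (D, C, 3), D, B, C, A, F, E)],
       [(AC, (E, F, 1), C, A, B, D, E, F), (AE, (E, F, 2), C, A, B, D, E, F),
        (AF, (E, F, 2), C, A, B, D, F, E), (BD, (E, F, 1), B, D, C, A, E, F),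
        (DE, (E, F, 2), B, D, C, A, E, F), (DF, (E, F, 2), B, D, C, A, F, E)]),
      ([AE, AF, BD, BE], [AD, BC], [BF, CD, CE, DF],
       [(BF, (D, B, 3), B, A, D, C, E, F), (CD, (D, C, 6), A, B, C, D, E, F),
        (CE, (D, D, 0), A, B, C, D, E, F), (DF, (D, B, 6), B, A, D, C, F, E)],
       [])]
   | (B, F) \<Rightarrow>
     [([AE, AF, BE, BF], [AD, BC], [CD, CE, DF],
       [(AC, (D, B, 3), A, B, C, D, E, F), (BD, (D, B, 3), B, A, D, C, E, F),
        (CE, (D, C, 2), A, B, C, D, E, F), (CF, (D, C, 2), A, B, C, D, F, E),
        (DE, (D, C, 2), B, A, D, C, E, F), (DF, (D, C, 2), B, A, D, C, F, E)],
       [(AC, (F, B, 5), C, D, A, F, B, E), (BD, (F, B, 5), D, C, B, E, A, F),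
        (CF, (F, B, 5), C, D, F, A, E, B), (DE, (F, B, 5), D, C, E, B, F, A)]),
      ([AE, AF, BE, CD], [AD, BC], [AC, BD, CE, DE],
       [(AC, (D, B, 1), A, B, C, D, E, F), (BD, (D, C, 6), A, B, C, D, E, F),
        (CE, (D, D, 0), A, C, B, D, E, F), (DE, (D, C, 1), B, A, D, C, E, F)],
       []),
      ([AE, AF, BE, CE], [AD, BC], [BD, CF, DF],
       [(BD, (D, D, 0), A, B, C, D, E, F), (BF, (D, C, 2), A, B, C, D, E, F),
        (CD, (D, D, 0), A, C, B, D, E, F), (CF, (D, C, 2), A, C, B, D, E, F),
        (DE, (D, C, 4), A, B, C, D, E, F), (DF, (D, C, 5), A, B, C, D, F, E)],
       [(BF, (F, C, 0), D, C, B, F, A, E), (CD, (F, C, 1), D, C, B, F, A, E),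
        (DE, (F, C, 2), D, C, B, F, A, E)]),
      ([AE, AF, BF, CE], [AD, BC], [BD, BE, CF, DF, EF],
       [(BE, (D, C, 2), A, B, C, D, E, F), (CF, (D, C, 2), A, C, B, D, F, E)],
       []),
      ([AE, AF, BD, CD], [AD, BC], [DE, DF],
       [(BE, (D, C, 6), A, B, C, D, E, F), (BF, (D, C, 6), A, B, C, D, F, E),
        (CE, (D, C, 6), A, C, B, D, E, F), (CF, (D, C, 6), A, C, B, D, F, E),
        (DE, (D, C, 0), B, A, D, C, E, F), (DF, (D, C, 0), B, A, D, C, F, E)],
       [(BE, (E, F, 3), D, B, C, A, E, F), (BF, (E, F, 3), D, B, C, A, F, E),
        (CE, (E, F, 3), D, C, B, A, E, F), (CF, (E, F, 3), D, C, B, A, F, E)]),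
      ([AD, BC, BD, DE], [AB, AC], [AF, CE, DF, EF],
       [(AF, (D, D, 1), A, B, C, D, E, F), (CE, (D, D, 2), A, C, B, D, E, F),
        (EF, (D, D, 3), A, B, C, E, D, F)],
       []),
      ([AE, BC, BD, DE], [AB, AC], [CE, DF],
       [(CE, (D, D, 2), A, B, C, E, D, F), (DF, (D, D, 4), A, B, C, D, E, F)],
       [])]
   | (C, A) \<Rightarrow>
     [([AF, BC, BD, DE], [AB, AC], [AD, BF, CF, DF],
       [(AD, (D, D, 1), A, B, C, D, E, F), (BF, (D, D, 5), A, B, C, D, E, F),
        (CF, (D, D, 6), A, C, B, D, E, F), (DF, (D, D, 4), A, B, C, D, F, E)],
       []),
      ([BC, BD, BF, DE], [AB, AC], [AF, CE, DF, EF],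
       [(AF, (D, D, 5), A, B, C, D, E, F), (CE, (D, E, 0), A, B, C, E, D, F),
        (EF, (D, E, 1), A, B, C, E, D, F)],
       []),
      ([BC, BE, CD, DE], [AB, AC], [AF, DF, EF],
       [(AD, (D, D, 2), A, B, C, D, E, F), (AE, (D, D, 2), A, C, B, E, D, F),
        (BF, (D, E, 0), A, B, C, D, E, F), (CF, (D, E, 0), A, C, B, E, D, F),
        (DF, (D, E, 2), A, B, C, D, E, F), (EF, (D, E, 2), A, C, B, E, D, F)],
       [(AD, (F, B, 5), A, F, D, E, B, C), (AE, (F, B, 5), A, F, E, D, C, B),
        (BF, (F, B, 5), F, A, B, C, D, E), (CF, (F, B, 5), F, A, C, B, E, D)]),
      ([BC, BF, CD, DE], [AB, AC], [AF, BD, BE, DF, EF],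
       [(AF, (D, D, 6), A, B, C, D, E, F), (BE, (D, E, 0), A, B, C, D, E, F),
        (DF, (D, E, 2), A, B, C, D, F, E)],
       []),
      ([BC, BD, DE, DF], [AB, AC], [CD, CE, CF],
       [(AE, (D, D, 4), A, B, C, D, E, F), (AF, (D, D, 4), A, B, C, D, F, E),
        (CE, (D, E, 2), A, C, B, D, E, F), (CF, (D, E, 2), A, C, B, D, F, E)],
       [(AE, (F, B, 6), C, A, B, D, E, F), (AF, (F, B, 6), C, A, B, D, F, E)]),
      ([BC, BE, DE, DF], [AB, AC], [AE, BF, CD, CF],
       [(AE, (D, D, 3), A, B, C, D, E, F), (BF, (D, E, 1), A, B, C, D, E, F),
        (CD, (D, E, 2), A, B, C, D, E, F)],
       []),
      ([AF, BC, BF, DE], [AB, AC], [BD, CD, EF],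
       [(BD, (D, D, 5), A, B, C, D, E, F), (BE, (D, D, 5), A, B, C, E, D, F),
        (CD, (D, D, 6), A, B, C, D, E, F), (CE, (D, D, 6), A, B, C, E, D, F),
        (DF, (D, D, 3), A, B, C, D, F, E), (EF, (D, D, 3), A, B, C, E, F, D)],
       [(BE, (F, C, 3), B, C, E, F, A, D), (CE, (F, C, 4), B, C, E, F, A, D),
        (DF, (F, C, 5), B, C, F, E, D, A)])]
   | (C, B) \<Rightarrow>
     [([AE, BC, DE, DF], [AB, AC], [BD, BE, CD, CE],
       [(BD, (D, D, 4), A, B, C, D, E, F), (BE, (D, D, 3), A, B, C, D, E, F),
        (CD, (D, D, 4), A, C, B, D, E, F), (CE, (D, D, 3), A, C, B, D, E, F)],
       []),
      ([AD, AF, BC, DE], [AB, AC], [BD, BF, CD, CF],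
       [(BD, (D, D, 1), A, B, C, D, E, F), (CD, (D, D, 1), A, C, B, D, E, F)],
       []),
      ([AC, AE, BD, BE], [AD, BC], [BF, CD, DF, EF],
       [(CD, (D, E, 3), A, B, C, D, E, F), (EF, (D, E, 4), A, B, C, D, E, F)],
       []),
      ([AC, AE, BE, CD], [AD, BC], [AF, BD, BF, DE, EF],
       [(AF, (D, B, 1), A, B, C, D, E, F), (BD, (D, E, 3), A, B, C, D, E, F),
        (BF, (D, C, 6), B, A, D, C, E, F), (DE, (D, E, 5), B, A, D, C, E, F)],
       []),
      ([AB, AE, BF, CE], [AD, BC], [CF, EF],
       [(CF, (D, B, 6), A, C, B, D, F, E), (EF, (D, E, 6), A, B, C, D, E, F)],
       []),
      ([AE, BD, BE, CE], [AD, BC], [AB, AF, CD, CF, EF],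
       [(AF, (D, D, 0), A, B, C, D, E, F), (CD, (D, E, 5), A, B, C, D, E, F),
        (CF, (D, C, 1), A, C, B, D, E, F)],
       []),
      ([AF, BD, BF, CE], [AD, BC], [BE, CD, CF, DE, EF],
       [(BE, (D, B, 4), A, B, C, D, E, F), (CF, (D, C, 1), A, C, B, D, F, E),
        (EF, (D, F, 0), A, B, C, D, E, F)],
       [])]
   | (C, C) \<Rightarrow>
     [([AC, AE, BE, EF], [AD, BC], [BD, CF, DE, DF],
       [(BD, (D, E, 4), A, B, C, D, E, F), (CF, (D, E, 6), A, C, B, D, E, F),
        (DF, (D, F, 0), B, A, D, C, F, E)],
       []),
      ([AE, BE, CE, DE], [AD, BC], [BD, CF, DF],
       [(AF, (D, C, 4), A, B, C, D, E, F), (BF, (D, C, 4), B, A, D, C, E, F),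
        (CF, (D, C, 4), C, A, D, B, E, F), (DF, (D, C, 4), D, B, C, A, E, F)],
       [(AF, (F, C, 2), D, C, B, F, A, E), (BF, (F, C, 6), D, C, B, F, A, E)]),
      ([AF, BE, CE, DE], [AD, BC], [AC, AE, CF, DF, EF],
       [(AE, (D, C, 4), A, B, C, D, E, F), (DF, (D, C, 5), D, B, C, A, F, E),
        (EF, (D, F, 1), A, B, C, D, E, F)],
       []),
      ([AE, BE, CE, EF], [AD, BC], [CD, DF],
       [(DF, (D, F, 1), D, B, C, A, E, F)],
       []),
      ([AE, BF, CE, EF], [AD, BC], [AB, AF, CD, CF, DE],
       [(AB, (D, E, 6), A, B, C, D, E, F), (CD, (D, F, 0), A, C, B, D, F, E),
        (DE, (D, F, 1), B, A, D, C, E, F)],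
       []),
      ([AB, AC, BF, CE], [AD, BC], [BE, CF, EF],
       [(BE, (D, B, 2), A, B, C, D, E, F), (CF, (D, B, 2), A, C, B, D, F, E),
        (EF, (D, F, 2), A, B, C, D, E, F)],
       []),
      ([AB, BD, BF, CE], [AD, BC], [BE, CF, EF],
       [(BE, (D, B, 0), A, B, C, D, E, F), (CF, (D, C, 0), A, C, B, D, F, E),
        (EF, (D, F, 3), A, B, C, D, E, F)],
       [])]
   | (C, D) \<Rightarrow>
     [([AB, BF, CE, EF], [AD, BC], [AC, AE, BD, BE, DF],
       [(AC, (D, F, 2), A, B, C, D, E, F), (AE, (D, E, 6), A, B, C, D, E, F),
        (BD, (D, F, 3), A, B, C, D, E, F), (DF, (D, F, 0), D, B, C, A, E, F)],
       []),
      ([AC, AF, BD, CD, CE], [AB], [AD, BF, CF, DF, EF],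
       [],
       []),
      ([AC, AE, CD, CF, DE], [AB], [BC, BF, DF, EF],
       [],
       []),
      ([AC, BC, CD, CF, DE], [AB], [CE, EF],
       [(EF, (D, F, 4), A, B, C, E, D, F)],
       []),
      ([AD, AE, BC, CD, CE], [AB], [AF, BD, BE, DF, EF],
       [],
       []),
      ([AF, BC, CD, CF, DE], [AB], [BE, CE, EF],
       [],
       []),
      ([AC, CE, CF, DE, DF], [AB], [AD, AE, BC, BF, CD],
       [(BC, (D, F, 4), A, B, C, D, E, F)],
       [])]
   | (C, E) \<Rightarrow>
     [([AD, AE, AF, CD, CE], [AB], [BC, BD, BE, CF],
       [],
       []),
      ([AD, AE, BD, CD, CE], [AB], [AF, BE, CF, DE, EF],
       [(BE, (D, F, 5), A, B, C, D, E, F), (CF, (D, F, 6), A, B, C, D, E, F)],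
       []),
      ([AD, AE, CD, CE, CF], [AB], [AF, BD, BE],
       [(BD, (D, F, 6), A, B, C, D, E, F), (BE, (D, F, 6), A, B, C, E, D, F)],
       []),
      ([AD, AF, BD, CD, CE], [AB], [BE, BF, CF, DF],
       [(BF, (E, A, 0), A, B, C, D, E, F), (CF, (D, F, 6), A, B, C, D, F, E)],
       []),
      ([AD, AF, BF, CD, CE], [AB], [AE, BD, CF, DF, EF],
       [(BD, (E, A, 0), A, B, C, D, E, F), (CF, (D, F, 6), A, B, C, F, D, E)],
       []),
      ([AD, BD, CD, CE, CF], [AB], [BE, BF],
       [(AE, (D, F, 6), A, B, C, D, E, F), (AF, (D, F, 6), A, B, C, D, F, E),
        (BE, (D, F, 6), B, A, C, D, E, F), (BF, (D, F, 6), B, A, C, D, F, E)],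
       [(AE, (F, A, 5), B, A, E, F, C, D), (AF, (F, A, 5), B, A, F, E, C, D)]),
      ([AE, BE, CD, CF, DE], [AB], [BC, BF, CE, DF, EF],
       [(EF, (D, F, 4), A, B, E, C, D, F)],
       [])]
   | (C, F) \<Rightarrow>
     [([AE, BD, CD, CE, CF], [AB], [AD, AF, BE, DE, EF],
       [(AD, (D, F, 6), A, B, C, D, E, F), (BE, (D, F, 6), B, A, C, E, D, F)],
       []),
      ([AC, AE, AF, BE, CD], [AB], [BC, BD, BF, DE, EF],
       [],
       []),
      ([AC, AE, BC, BE, CD], [AB], [CF, DE, DF],
       [(DE, (D, F, 5), A, B, D, C, E, F), (DF, (E, A, 0), A, B, D, C, F, E)],
       []),
      ([AC, AF, BC, BE, CD], [AB], [BF, CE, DF],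
       [],
       []),
      ([AD, AE, BC, BE, CD], [AB], [CE, CF, DE, DF],
       [],
       []),
      ([AE, AF, BE, BF, CD], [AB], [CE, CF, DE, DF],
       [(CE, (E, A, 0), A, B, C, E, D, F), (CF, (E, A, 0), A, B, C, F, D, E),
        (DE, (E, A, 0), A, B, D, E, C, F), (DF, (E, A, 0), A, B, D, F, C, E)],
       []),
      ([AF, BD, DE, DF], [AD, AE, BC], [AB, CD, CE, EF],
       [(AB, (E, B, 1), A, B, C, D, E, F), (CD, (E, B, 2), A, B, C, D, E, F),
        (CE, (E, B, 3), A, C, B, D, E, F)],
       [])]
   | (D, A) \<Rightarrow>
     [([AB, AF, DE, DF], [AD, AE, BC], [AC, BD, BE, CF],
       [(AC, (E, B, 4), A, B, C, D, E, F), (BD, (E, B, 1), A, B, C, D, E, F),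
        (BE, (E, B, 5), A, B, C, D, E, F), (CF, (E, B, 6), A, C, B, D, E, F)],
       []),
      ([AF, BF, DE, DF], [AD, AE, BC], [AC, BE, CF],
       [(AC, (E, B, 6), A, B, C, D, E, F), (BE, (E, C, 0), A, B, C, D, E, F),
        (CF, (E, C, 1), A, B, C, D, E, F)],
       []),
      ([AF, BE, DE, DF], [AD, AE, BC], [AB, BF, CD, CE],
       [(AB, (E, B, 5), A, B, C, D, E, F), (BF, (E, C, 0), A, B, C, D, E, F),
        (CD, (E, B, 3), A, B, C, D, E, F), (CE, (E, C, 2), A, B, C, D, E, F)],
       []),
      ([AB, AC, BD, DE], [AD, AE, BC], [DF, EF],
       [(BF, (E, C, 3), A, B, C, D, E, F), (CD, (E, C, 4), A, B, C, D, E, F),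
        (CE, (E, C, 5), A, B, C, E, D, F), (EF, (E, C, 6), A, B, C, E, D, F)],
       [(BF, (F, C, 5), D, E, B, C, A, F), (CD, (F, D, 0), D, E, B, C, A, F),
        (CE, (F, D, 1), E, D, B, C, A, F)]),
      ([AB, AC, BF, DE], [AD, AE, BC], [CF],
       [(BD, (E, C, 3), A, B, C, D, E, F), (BE, (E, C, 3), A, B, C, E, D, F),
        (CF, (E, D, 0), A, B, C, D, E, F), (DF, (E, D, 1), A, B, C, D, E, F),
        (EF, (E, D, 1), A, B, C, E, D, F)],
       [(BD, (F, A, 3), A, C, B, F, D, E), (BE, (F, A, 3), A, C, B, F, E, D),
        (DF, (F, A, 4), A, C, F, B, D, E), (EF, (F, A, 4), A, C, F, B, E, D)]),
      ([AB, AC, DE, DF], [AD, AE, BC], [AF],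
       [(AF, (E, B, 4), A, B, C, D, E, F), (BE, (E, C, 6), A, B, C, D, E, F),
        (BF, (E, D, 1), A, B, C, D, E, F), (CE, (E, C, 6), A, C, B, D, E, F),
        (CF, (E, D, 1), A, C, B, D, E, F)],
       [(BE, (E, F, 3), A, B, C, D, E, F), (BF, (E, F, 3), A, B, C, D, F, E),
        (CE, (E, F, 3), A, C, B, D, E, F), (CF, (E, F, 3), A, C, B, D, F, E)]),
      ([AB, AC, AF, DE], [AD, AE, BC], [DF, EF],
       [(DF, (E, B, 4), A, B, C, D, E, F), (EF, (E, B, 4), A, B, C, E, D, F)],
       [])]
   | (D, B) \<Rightarrow>
     [([AB, BD, BE, BF, CE], [AD, BC], [CF],
       [(CF, (E, D, 2), A, B, C, D, E, F)],
       []),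
      ([AC, AE, AF, BE, CD], [AD, BC], [BD, BF, DE, EF],
       [],
       []),
      ([AB, AC, BE, BF, CE], [AD, BC], [CF, EF],
       [(CF, (E, D, 3), A, B, C, D, E, F)],
       []),
      ([AC, AE, AF, BE, BF], [AD, BC], [AB, CD, DF, EF],
       [],
       []),
      ([AF, BD, BE, BF, CE], [AD, BC], [CD, CF, DE],
       [],
       []),
      ([AB, BE, BF, CE, CF], [AD, BC], [AC, BD, DF],
       [(AC, (E, D, 3), A, B, C, D, E, F), (BD, (E, D, 2), A, B, C, D, E, F)],
       []),
      ([AC, AF, BE, BF, CE], [AD, BC], [CD, DE, DF],
       [],
       [])]
   | (D, C) \<Rightarrow>
     [([AC, BE, BF, CD, CE], [AD, BC], [CF, DE],
       [(CF, (E, D, 2), A, C, B, D, E, F)],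
       []),
      ([AE, BE, BF, CD, CE], [AD, BC], [BD, CF, DE, DF],
       [],
       []),
      ([AE, AF, BE, BF, CE], [AD, BC], [BD, CF, DF],
       [(CF, (E, D, 4), A, B, C, D, E, F)],
       []),
      ([AE, BE, BF, CE, CF], [AD, BC], [AF, DE],
       [(AF, (E, D, 4), A, B, C, D, E, F), (DE, (E, D, 5), A, B, C, D, E, F)],
       []),
      ([AE, AF, BE, CE, DE], [AD, BC], [AB, CF, DF],
       [(DF, (E, D, 5), B, A, D, C, E, F)],
       []),
      ([AE, AF, BF, CF, DE], [AD, BC], [DF],
       [(DF, (E, D, 5), B, A, D, C, F, E)],
       []),
      ([AE, AF, BD, BE, CD], [AD, BC], [AC, BF, CE],
       [(CE, (E, D, 6), A, B, C, D, E, F)],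
       [])]
   | (D, D) \<Rightarrow>
     [([AE, AF, BD, BE, CE], [AD, BC], [BF, CD, DF],
       [(CD, (E, D, 6), A, B, C, D, E, F)],
       []),
      ([AD, AF, BC, BD, DE], [AB, AC], [BF, CD, EF],
       [],
       []),
      ([AD, BC, BE, CD, DE], [AB, AC], [BD, EF],
       [(EF, (E, E, 0), A, C, B, E, D, F)],
       []),
      ([AE, BC, BE, DE, DF], [AB, AC], [AF, BD, CD],
       [(CD, (E, E, 0), A, B, C, D, E, F)],
       []),
      ([AE, BC, BD, DE, DF], [AB, AC], [AF, BE, CE, EF],
       [(CE, (E, E, 0), A, C, B, D, E, F)],
       []),
      ([AF, BC, BD, BF, DE], [AB, AC], [AD, CE, EF],
       [],
       []),
      ([AF, BC, BF, CD, DE], [AB, AC], [AD, DF, EF],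
       [(DF, (E, E, 0), A, B, C, D, F, E)],
       [])]
   | (D, E) \<Rightarrow>
     [([BC, BE, BF, CD, DE], [AB, AC], [AE],
       [],
       []),
      ([BC, BE, BF, DE, DF], [AB, AC], [AF],
       [],
       []),
      ([BC, BE, CD, DE, DF], [AB, AC], [AE],
       [(AE, (E, E, 0), A, B, C, D, E, F)],
       []),
      ([AC, AE, BD, BE, CD], [AD, BC], [AB, EF],
       [],
       []),
      ([AC, AE, BD, BE, EF], [AD, BC], [AB, BF, CD, DF],
       [],
       []),
      ([AE, BD, BE, CD, CE], [AD, BC], [AF, EF],
       [(AF, (E, D, 6), A, B, C, D, E, F)],
       []),
      ([AB, AE, BF, CE, EF], [AD, BC], [CD, CF, DE],
       [],
       [])]
   | (D, F) \<Rightarrow>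
     [([AF, BD, BF, CE, EF], [AD, BC], [AC, AE, BE],
       [],
       []),
      ([AF, BE, CE, DE, EF], [AD, BC], [AB, CD],
       [],
       []),
      ([AB, AC, BF, CE, EF], [AD, BC], [CF],
       [],
       []),
      ([AB, BD, BF, CE, EF], [AD, BC], [AC, AE, BE, DF],
       [],
       []),
      ([AC, BC, CE, CF, DE, DF], [AB], [AE, BF],
       [],
       []),
      ([AD, AE, BD, BE, CD, CE], [AB], [CF, DE, EF],
       [(CF, (E, E, 1), A, B, C, D, E, F)],
       []),
      ([AD, AE, BD, CD, CE, CF], [AB], [AF, BE, EF],
       [(BE, (E, E, 1), A, B, C, D, E, F)],
       [])]
   | (E, A) \<Rightarrow>
     [([AD, AF, BD, BF, CD, CE], [AB], [CF, DE, EF],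
       [(CF, (E, E, 1), A, B, C, D, F, E)],
       []),
      ([AE, AF, CD, CE], [AC, AD, BC, BD], [BE, CF, DF],
       [(BE, (E, F, 4), A, B, C, D, E, F), (CF, (E, F, 1), C, D, A, B, E, F),
        (DF, (E, F, 5), C, D, A, B, F, E)],
       []),
      ([AE, AF, BE, CD], [AC, AD, BC, BD], [BF, CE, DE],
       [(CE, (E, F, 4), A, B, C, D, E, F), (DE, (E, F, 4), A, B, D, C, E, F)],
       []),
      ([AB, AE, CD, EF], [AC, AD, BC, BD], [CE, DE],
       [(CE, (E, F, 6), A, B, C, D, E, F), (DE, (E, F, 6), A, B, D, C, E, F)],
       []),
      ([BF, CF, DF, EF], [AB, AD, AE, BC], [AF],
       [],
       []),
      ([BD, CF, DF, EF], [AB, AD, AE, BC], [CE],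
       [(AC, (F, A, 0), A, B, C, D, E, F), (AF, (F, A, 1), A, B, C, D, E, F),
        (BE, (F, A, 2), A, B, C, D, E, F)],
       [(AC, (F, C, 1), A, C, E, B, D, F), (AF, (F, C, 2), A, C, E, B, D, F),
        (BE, (F, C, 0), A, C, E, B, D, F)]),
      ([AF, CF, DF, EF], [AB, AD, AE, BC], [CE],
       [(BD, (F, A, 1), A, B, C, D, E, F), (BE, (F, A, 1), A, B, C, E, D, F)],
       [(BD, (F, C, 2), A, C, E, B, D, F), (BE, (F, C, 6), A, C, E, B, D, F)])]
   | (E, B) \<Rightarrow>
     [([AC, CF, DF, EF], [AB, AD, AE, BC], [AF],
       [(BD, (F, A, 0), A, B, C, D, E, F), (BE, (F, A, 0), A, B, C, E, D, F)],
       [(BD, (F, B, 6), A, B, C, F, D, E), (BE, (F, B, 6), A, B, C, F, E, D)]),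
      ([AB, AF, BD, DE, DF], [AD, AE, BC], [BF, CD, CE],
       [],
       []),
      ([AF, BD, CD, DE, DF], [AD, AE, BC], [AC],
       [],
       []),
      ([AF, BE, CD, DE, DF], [AD, AE, BC], [AC],
       [],
       []),
      ([AB, AC, AF, DE, DF], [AD, AE, BC], [EF],
       [],
       []),
      ([AB, AF, BE, DE, DF], [AD, AE, BC], [AC, CF, EF],
       [],
       []),
      ([AC, AF, BF, DE, DF], [AD, AE, BC], [AB, CD, CE],
       [],
       [])]
   | (E, C) \<Rightarrow>
     [([AF, BE, BF, DE, DF], [AD, AE, BC], [CD, CE, CF],
       [],
       []),
      ([AF, BF, CF, DE, DF], [AD, AE, BC], [CD],
       [],
       []),
      ([AF, BE, CE, DE, DF], [AD, AE, BC], [AC, CF],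
       [],
       []),
      ([AB, AC, BD, BF, DE], [AD, AE, BC], [CF],
       [],
       []),
      ([AB, AC, BD, CD, DE], [AD, AE, BC], [CF, DF, EF],
       [(EF, (F, A, 6), A, B, C, E, D, F)],
       []),
      ([AB, AC, BE, CD, DE], [AD, AE, BC], [DF, EF],
       [],
       []),
      ([AB, AC, BE, DE, DF], [AD, AE, BC], [AF, BF, CE],
       [(CE, (F, A, 6), A, B, C, D, E, F)],
       [])]
   | (E, D) \<Rightarrow>
     [([AB, AC, BF, CF, DE], [AD, AE, BC], [DF, EF],
       [(DF, (F, B, 0), A, B, C, D, E, F), (EF, (F, B, 0), A, B, C, E, D, F)],
       []),
      ([AB, AC, BF, DE, DF], [AD, AE, BC], [AF, CF],
       [(CF, (F, B, 0), A, B, C, D, E, F)],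
       []),
      ([AB, BD, BE, BF, CE, CF], [AD, BC], [DF],
       [],
       []),
      ([AB, AC, BE, BF, CE, CF], [AD, BC], [CD, DF],
       [],
       []),
      ([AE, AF, BE, BF, CE, CF], [AD, BC], [CD],
       [],
       []),
      ([AE, BE, BF, CE, CF, DE], [AD, BC], [AC, DF],
       [],
       []),
      ([AE, AF, BD, BE, CD, CE], [AD, BC], [AC, CF],
       [],
       [])]
   | (E, E) \<Rightarrow>
     [([AE, BC, BE, CD, DE, DF], [AB, AC], [BD, EF],
       [],
       []),
      ([AD, AE, BD, BE, CD, CE, CF], [AB], [BC, DE],
       [],
       []),
      ([AC, CD, CE, EF], [AB, AE, AF, BC, BD], [DF],
       [(DF, (F, B, 5), A, B, C, D, F, E)],
       []),
      ([AD, CD, CE, EF], [AB, AE, AF, BC, BD], [CF, DF],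
       [(DF, (F, B, 5), A, B, D, C, E, F)],
       []),
      ([AB, AC, AD, CE], [AE, AF, BE, BF, CD], [DE, DF],
       [(DE, (F, D, 0), A, B, C, D, E, F), (DF, (F, C, 3), A, B, C, D, F, E)],
       []),
      ([AB, AC, AD, EF], [AE, AF, BE, BF, CD], [DE, DF],
       [],
       []),
      ([AB, AC, CE, EF], [AE, AF, BE, BF, CD], [DE, DF],
       [],
       [])]
   | (E, F) \<Rightarrow>
     [([AB, AD, BC, EF], [AE, AF, BE, BF, CD], [DE, DF],
       [],
       []),
      ([AB, AE, AF, CE, CF], [AC, AD, BC, BD], [DF],
       [],
       []),
      ([AE, AF, BE, CE, CF], [AC, AD, BC, BD], [BF, DE],
       [(BF, (F, D, 2), A, B, C, D, E, F), (DE, (F, D, 3), A, B, C, D, E, F)],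
       []),
      ([AB, AC, BE, DE, DF], [AD, AE, AF, BC], [CE],
       [(CE, (F, D, 4), A, B, C, D, E, F)],
       []),
      ([AE, AF, BE, CD, CE], [AC, AD, BC, BD], [BF],
       [],
       []),
      ([AB, AF, BE, CE, CF], [AC, AD, BC, BD], [EF],
       [],
       []),
      ([AB, AE, CD, CE, EF], [AC, AD, BC, BD], [DF],
       [],
       [])]
   | (F, A) \<Rightarrow>
     [([AC, BD, CF, DF, EF], [AB, AD, AE, BC], [CD, CE],
       [],
       []),
      ([AF, BD, CF, DF, EF], [AB, AD, AE, BC], [CD],
       [],
       []),
      ([BD, BE, CF, DF, EF], [AB, AD, AE, BC], [AF],
       [],
       []),
      ([AB, AC, CD, CE, EF], [AE, AF, BC, BD], [BE],
       [],
       []),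
      ([AB, AD, CD, CE, EF], [AE, AF, BC, BD], [AC],
       [],
       []),
      ([AF, BC, BF, CE, DE, EF], [AB, AC, AD], [BE],
       [],
       []),
      ([AB, AC, BE, CE, DE, DF], [AD, AE, BC], [CD],
       [],
       [])]
   | (F, B) \<Rightarrow>
     [([AB, AC, BF, CF, DE, DF], [AD, AE, BC], [AF, CE],
       [],
       []),
      ([AF, CD, CE, CF], [AC, AD, AE, BC, BD, BE], [EF],
       [],
       []),
      ([AE, CE, DF, EF], [AB, AD, AF, BC, BE, CD], [CF],
       [],
       []),
      ([AC, CE, DF, EF], [AB, AD, AF, BC, BE, CD], [CF],
       [],
       []),
      ([AB, CD, CF, DE], [AC, AD, AE, BC, BD, BE], [EF],
       [],
       []),
      ([AC, CD, CF, DE, EF], [AB, AE, AF, BC, BD], [CE],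
       [],
       []),
      ([AC, BE, CD, DE, DF], [AB, AD, AE, AF, BC], [CE],
       [],
       [])]
   | (F, C) \<Rightarrow>
     [([BF, CD, CF, DE, EF], [AC, AD, AE, BC, BD], [AF],
       [],
       []),
      ([AB, BF, CF, DE, EF], [AC, AD, AE, BC, BD], [AF],
       [],
       []),
      ([AF, BF, CF, DE, EF], [AC, AD, AE, BC, BD], [DF],
       [],
       []),
      ([AB, AC, AD, CF, DE], [AE, AF, BE, BF, CD], [DF],
       [],
       []),
      ([AB, AD, BC, CF, DE], [AE, AF, BE, BF, CD], [DF],
       [],
       []),
      ([AB, AC, CE, CF, DE], [AE, AF, BE, BF, CD], [DF],
       [],
       []),
      ([AF, BF, CD, CF, EF], [AC, AD, AE, BC, BD], [BE],
       [],
       [])]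
   | (F, D) \<Rightarrow>
     [([AB, AC, AD, CE, DE], [AE, AF, BE, BF, CD], [DF],
       [],
       []),
      ([AB, AD, BC, CE, DE], [AE, AF, BE, BF, CD], [DF],
       [],
       []),
      ([AE, AF, BE, BF, CE, CF], [AC, AD, BC, BD], [DF],
       [],
       []),
      ([AE, AF, BE, CE, CF, DE], [AC, AD, BC, BD], [DF],
       [],
       []),
      ([AB, AC, BE, CE, DE, DF], [AD, AE, AF, BC], [CF],
       [],
       [])]
   | _ \<Rightarrow> [])"

section \<open>Evaluation of the table and the conclusion for the game\<close>

definition row_ok :: "vertex \<Rightarrow> bool" where
  "row_ok x \<longleftrightarrow> list_all (entry_ok table) (concat (map (table x) vertices))"

text \<open>The check is split into six evaluations. \<open>code_simp\<close> performs them by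
  simplification with the code equations, so every step passes through the kernel and no compiled
  code is trusted.\<close>

lemma row_ok: "row_ok A" "row_ok B" "row_ok C" "row_ok D" "row_ok E" "row_ok F"
  by code_simp+

lemma table_ok:
  assumes "d \<in> set (table x y)"
  shows "entry_ok table d"
proof -
  have "row_ok x" by (cases x) (simp_all add: row_ok)
  then show ?thesis using assms by (auto simp: row_ok_def list_all_iff set_vertices)
qed

lemma safe_first_edge:
  assumes "e \<in> K6"
  shows "sim.safe {e} {}"
proof -
  obtain a b where ab: "e = {a, b}" "a \<noteq> b" "a < 6" "b < 6"
    using assms by (auto simp: complete_graph_def card_2_iff)
  \<comment> \<open>The root of the table: a single red edge. All edges of \<open>K6\<close> are
    equivalent under relabelling, so this one entry covers every choice of a first edge.\<close>
  obtain d where "([AB], [], d) \<in> set (table A A)"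
    unfolding table_def by fastforce
  from entries_safe[OF table_ok this] have safe: "sim.safe {{0, 1}} {}"
    by (simp add: edge_def insert_commute)
  \<comment> \<open>The outer transposition sends 0 to \<open>a\<close>; the inner one first moves 1
    to the point that the outer one sends to \<open>b\<close>. That point is not 0 because
    \<open>a\<close> and \<open>b\<close> differ, so 0 is left alone by the inner one.\<close>
  define \<pi> where "\<pi> = transpose 0 a \<circ> transpose 1 (transpose 0 a b)"
  have "\<pi> permutes {..<6}"
    unfolding \<pi>_def using ab
    by (intro permutes_compose permutes_swap_id) (auto simp: transpose_def)
  then have "bij_betw \<pi> {..<6} {..<6}" by (rule permutes_imp_bij)
  moreover have "{{0, 1::nat}} \<subseteq> K6" by (auto simp: complete_graph_def)
  ultimately have "sim.safe ((`) \<pi> ` {{0, 1}}) ((`) \<pi> ` {})"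
    using safe by (intro safe_vertex_image) auto
  moreover have "\<pi> 0 = a" "\<pi> 1 = b"
    using ab by (auto simp: \<pi>_def transpose_def)
  ultimately show ?thesis by (simp add: ab(1))
qed

theorem theorem14: "\<exists>\<sigma>. winning_strategy sim_plus Green \<sigma>"
proof (rule winning_strategy_if_wins)
  let ?E = "edges (board sim_plus)"
  let ?ok = "\<lambda>S. \<not> contains_copy (verts (board sim_plus), S) (forbidden sim_plus)"
  \<comment> \<open>These equations identify the board and the rule of \<open>sim_plus\<close> with
    the parameters of the instance \<open>sim\<close>, whose facts then apply to the game.\<close>
  have E: "?E = K6" and ok: "?ok = triangle_free"
    by (simp_all add: sim_plus_def triangle_free_def fun_eq_iff) (simp add: complete_graph_def)
  show "avoidance ?ok" unfolding ok by (rule sim.avoidance_axioms)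
  show "finite ?E" unfolding E by (rule finite_K6)
  show "avoidance.wins ?E ?ok (initially_red sim_plus \<union> M) (initially_green sim_plus)"
    if "M \<in> avoidance.moves ?E ?ok (initially_red sim_plus) (initially_green sim_plus)" for M
    using sim.wins_first_move[OF safe_first_edge] that unfolding E ok by (simp add: sim_plus_def)
qed

end
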